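(* Let $\zeta_1,\dots,\zeta_n\in\partial\mathbb{D}$ be distinct, $b_1,\dots,b_n>0$, $a\in\mathbb{R}$, $b=\sum_kb_k$, $\hat a=a/b$, and let $\xi_1,\dots,\xi_n\in\partial\mathbb{D}$ and $\alpha_1,\dots,\alpha_n<0$ be as defined below. Then the radial Loewner–Kufarev PDE on $\mathbb{D}\times[0,\infty)$, $$\frac{\partial f}{\partial t}(z,t)=-f'(z,t)\,z\sum_{k=1}^n b_k\frac{e^{iat}\zeta_k+z}{e^{iat}\zeta_k-z},\qquad f(z,0)=z,$$ has the unique solution $f(z,t)=\phi^{-1}\big(e^{-(b-ia)t}\phi(e^{-iat}z)\big)$, where $$\phi(z)=z\Big(\prod_{k=1}^n(z-\xi_k)^{2\alpha_k}\Big)^{e^{i(\operatorname{Arccot}(\hat a)-\pi/2)}}$$ is an $(\operatorname{Arccot}(\hat a)-\tfrac{\pi}{2})$-spirallike function of $\mathbb{D}$. Moreover, for each $k$, the trace $\hat\gamma_k=\{\gamma_k(t):=f(e^{iat}\zeta_k,t):t\ge0\}$ (boundary values of $f(\cdot,t)$) is a smooth curve lying in $\mathbb{D}$ (except its initial point) that starts perpendicularly from $\zeta_k$ (i.e. $\operatorname{Arg}(1-\bar\zeta_k\gamma_k(t))\to0$ as $t\to0^+$) and, writing $\gamma_k(t)=r_k(t)e^{i\Theta_k(t)}$ with $\Theta_k$ continuous, $r_k$ decreases to $0$ and, when $a\neq0$, $\operatorname{sgn}(a)\Theta_k(t)$ is eventually increasing and tends to $+\infty$ (the trace spirals about the ori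gin).
   Context: Definitions of $\xi_k,\alpha_k$: write $R(z)=\prod_k(\zeta_k-z)$, $Q(z)=\sum_kb_k(\zeta_k+z)\prod_{j\neq k}(\zeta_j-z)$, $\xi_{\hat a}=\frac{1+i\hat a}{1-i\hat a}$, and $Q-iaR=(-1)^{n-1}(b+ia)\prod_k(z-\xi_k)$; then $\xi_k\in\partial\mathbb{D}$ are distinct, and $\alpha_k:=\frac{(-1)^{n-1}}{2}e^{-i\operatorname{Arg}(\xi_{\hat a})/2}\frac{R(\xi_k)}{\xi_k\prod_{j\neq k}(\xi_k-\xi_j)}$ are negative reals. The powers in $\phi$ are defined via holomorphic branches of $\log(z-\xi_k)$ on $\mathbb{D}$. $\operatorname{Arccot}$ takes values in $(0,\pi)$; $\operatorname{Arg}$ is the principal argument. A simply connected domain $D\ni0$ is $\psi$-spirallike if for every $w_0\in D$ the arc $\{w_0\exp(-e^{i\psi}s):0\le s\le\infty\}$ lies in $D$; a univalent $f\in H(\mathbb{D})$ with $f(0)=0$ is $\psi$-spirallike if $f(\mathbb{D})$ is $\psi$-spirallike. *)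

theory Defs
  imports "HOL-Complex_Analysis.Complex_Analysis"
begin

definition Arccot :: "real \<Rightarrow> real" where
  "Arccot x = pi / 2 - arctan x"

definition spirallike_domain :: "real \<Rightarrow> complex set \<Rightarrow> bool" where
  "spirallike_domain \<psi> D \<longleftrightarrow> open D \<and> simply_connected D \<and> 0 \<in> D \<and>
     (\<forall>w0\<in>D. \<forall>s::real. s \<ge> 0 \<longrightarrow> w0 * exp (- exp (\<i> * of_real \<psi>) * of_real s) \<in> D)"

definition spirallike :: "real \<Rightarrow> (complex \<Rightarrow> complex) \<Rightarrow> bool" where
  "spirallike \<psi> f \<longleftrightarrow> f holomorphic_on ball 0 1 \<and> inj_on f (ball 0 1) \<and> f 0 = 0 \<and>
     spirallike_domain \<psi> (f ` ball 0 1)"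

definition LK_R :: "nat \<Rightarrow> (nat \<Rightarrow> complex) \<Rightarrow> complex \<Rightarrow> complex" where
  "LK_R n \<zeta> z = (\<Prod>k<n. \<zeta> k - z)"

definition LK_Q :: "nat \<Rightarrow> (nat \<Rightarrow> complex) \<Rightarrow> (nat \<Rightarrow> real) \<Rightarrow> complex \<Rightarrow> complex" where
  "LK_Q n \<zeta> bs z = (\<Sum>k<n. of_real (bs k) * (\<zeta> k + z) * (\<Prod>j\<in>{..<n} - {k}. \<zeta> j - z))"

definition xi_hat :: "real \<Rightarrow> complex" where
  "xi_hat ah = (1 + \<i> * of_real ah) / (1 - \<i> * of_real ah)"

text \<open>alpha_k, for given xi (roots of Q - i a R), ahat = a/b.\<close>
definition LK_alpha :: "nat \<Rightarrow> (nat \<Rightarrow> complex) \<Rightarrow> real \<Rightarrow> (nat \<Rightarrow> complex) \<Rightarrow> nat \<Rightarrow> complex" where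
  "LK_alpha n \<zeta> ah \<xi> k =
     ((-1) ^ (n - 1) / 2) * exp (- \<i> * of_real (Arg (xi_hat ah)) / 2) *
     LK_R n \<zeta> (\<xi> k) / (\<xi> k * (\<Prod>j\<in>{..<n} - {k}. \<xi> k - \<xi> j))"

text \<open>phi(z) = z (prod_k (z - xi_k)^(2 alpha_k))^c, where the powers are taken via
  holomorphic branches L k of log(z - xi_k) on the disc:
  (z - xi_k)^(2 alpha_k) = exp(2 alpha_k L_k z), and the outer power via the
  corresponding logarithm sum_k 2 alpha_k L_k z of the product.\<close>
definition LK_phi :: "nat \<Rightarrow> (nat \<Rightarrow> complex) \<Rightarrow> complex \<Rightarrow> (nat \<Rightarrow> complex \<Rightarrow> complex) \<Rightarrow> complex \<Rightarrow> complex" where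
  "LK_phi n \<alpha> c L z = z * exp (c * (\<Sum>k<n. 2 * \<alpha> k * L k z))"

definition LK_solution :: "nat \<Rightarrow> (nat \<Rightarrow> complex) \<Rightarrow> (nat \<Rightarrow> real) \<Rightarrow> real \<Rightarrow>
    (complex \<Rightarrow> real \<Rightarrow> complex) \<Rightarrow> bool" where
  "LK_solution n \<zeta> bs a f \<longleftrightarrow>
     continuous_on (ball 0 1 \<times> {0..}) (\<lambda>(z, t). f z t) \<and>
     (\<forall>t\<ge>0. (\<lambda>z. f z t) holomorphic_on ball 0 1) \<and>
     (\<forall>z\<in>ball 0 1. f z 0 = z) \<and>
     (\<forall>z\<in>ball 0 1. \<forall>t\<ge>0.
        ((\<lambda>s. f z s) has_vector_derivative
           (- deriv (\<lambda>w. f w t) z * z *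
              (\<Sum>k<n. of_real (bs k) * (exp (\<i> * of_real (a * t)) * \<zeta> k + z) /
                                      (exp (\<i> * of_real (a * t)) * \<zeta> k - z))))
        (at t within {0..}))"

definition higher_vderiv :: "nat \<Rightarrow> (real \<Rightarrow> complex) \<Rightarrow> real \<Rightarrow> complex" where
  "higher_vderiv m g = ((\<lambda>h s. vector_derivative h (at s)) ^^ m) g"

definition smooth_curve_on :: "real set \<Rightarrow> (real \<Rightarrow> complex) \<Rightarrow> bool" where
  "smooth_curve_on S g \<longleftrightarrow> (\<forall>m. \<forall>t\<in>S. higher_vderiv m g differentiable at t)"

end

theory Submission
  imports Defs
begin

text \<open>
  Write \<open>p\<close> for the Herglotz function \<open>Q / R\<close> and \<open>\<lambda> = b - \<i> a\<close>. On the unit circle \<open>p\<close> is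
  imaginary and \<open>z p'\<close> is negative, so the roots \<open>\<xi> k\<close> of \<open>p - \<i> a\<close> are simple and unimodular and the
  residues of \<open>\<lambda> / (p - \<i> a)\<close> give the negative exponents; partial fractions then show that
  \<open>z \<phi>' / \<phi> = \<lambda> / (p - \<i> a)\<close>. Hence \<open>\<phi>\<close> linearises the field \<open>- w (p w - \<i> a)\<close>: multiplying \<open>\<phi>\<close> by
  \<open>exp (- \<lambda> t)\<close> is the flow of this field, along which \<open>|w|\<close> decreases because \<open>Re p > 0\<close>. This makes the
  image spirallike and solves the equation after a rotation; uniqueness follows along characteristics.
  At a pole \<open>\<zeta> k\<close> of \<open>p\<close>, \<open>\<phi>\<close> has the form \<open>C exp (- \<lambda> q\<^sup>2)\<close> with \<open>q\<close> conformal, so the trace is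
  \<open>q\<^sup>-\<^sup>1 (\<surd>t)\<close> near \<open>t = 0\<close> and a trajectory of the flow afterwards.
\<close>

section \<open>Spirallike functions generated by a function of positive real part\<close>

text \<open>The angle of the outer power and the sign of the exponents have one source. At a root of
  \<open>p - \<i> a\<close> the value of \<open>z p'\<close> is real and negative, so the
  coefficients \<open>lam / (\<xi> k * herglotz' (\<xi> k))\<close> are negative multiples of
  \<open>lam\<close>; pulling the unimodular part of \<open>lam\<close> out of the sum leaves real
  negative exponents. The summand \<open>- \<i> a\<close> of the field comes from passing to the
  frame that rotates with the poles, in which they stand still.

  No existence theorem for differential equations enters: trajectories are written down through the
  inverse of \<open>phi\<close>, and it only remains to see that they stay in its image, which is a
  compactness argument. The obstacle is the boundary, where the inverse is not controlled. A pole of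
  \<open>p\<close> makes \<open>phi' / phi\<close> vanish to first order, so \<open>log phi\<close>
  has a nondegenerate critical point there; this is where the square root comes from. For
  \<open>t > 0\<close> the limit \<open>C * exp (- lam * t)\<close> is interior to the image, so
  continuity of the inverse at that point yields the boundary values.\<close>

lemma Re_pos_deriv_inj_on:
  fixes f f' :: "complex \<Rightarrow> complex" and c :: complex
  assumes "convex S"
    and der: "\<And>z. z \<in> S \<Longrightarrow> (f has_field_derivative f' z) (at z)"
    and pos: "\<And>z. z \<in> S \<Longrightarrow> 0 < Re (c * f' z)"
  shows "inj_on f S"
proof (rule inj_onI, rule ccontr)
  fix u v assume uv: "u \<in> S" "v \<in> S" "f u = f v" "u \<noteq> v"
  have seg: "closed_segment u v \<subseteq> S"
    using assms(1) uv by (simp add: closed_segment_subset)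
  \<comment> \<open>After division by \<open>v - u\<close> the increment in the mean value theorem
    is \<open>c * f' x\<close> itself; its real part is positive although
    \<open>F u = F v\<close>.\<close>
  define F where "F = (\<lambda>z. c * f z / (v - u))"
  have "(F has_field_derivative c * f' z / (v - u)) (at z)" if "z \<in> closed_segment u v" for z
    unfolding F_def using seg that uv by (auto intro!: derivative_eq_intros der)
  from complex_mvt_line[of u v F, OF this] obtain x where
    x: "x \<in> closed_segment u v" "Re (F v) - Re (F u) = Re (c * f' x / (v - u) * (v - u))"
    by blast
  have "c * f' x / (v - u) * (v - u) = c * f' x"
    using uv by simp
  moreover have "F v = F u" by (simp add: F_def uv)
  ultimately show False using pos[of x] x seg by auto
qed

text \<open>Along \<open>w' = - w q\<close> the derivative of \<open>|w|^2\<close> is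
  \<open>- 2 |w|^2 Re q\<close>, which is strictly negative as long as \<open>w\<close> avoids
  0.\<close>

lemma norm_antimono_of_field:
  fixes w :: "real \<Rightarrow> complex"
  assumes "s < t"
    and der: "\<And>x. s \<le> x \<Longrightarrow> x \<le> t \<Longrightarrow> (w has_vector_derivative - w x * q x) (at x)"
    and pos: "\<And>x. s \<le> x \<Longrightarrow> x \<le> t \<Longrightarrow> 0 < Re (q x)"
  shows "norm (w t) \<le> norm (w s)"
    and "(\<And>x. s \<le> x \<Longrightarrow> x \<le> t \<Longrightarrow> w x \<noteq> 0) \<Longrightarrow> norm (w t) < norm (w s)"
proof -
  define N where "N = (\<lambda>x. (norm (w x))\<^sup>2)"
  have d: "(N has_real_derivative - 2 * (norm (w x))\<^sup>2 * Re (q x)) (at x)"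
    if "s \<le> x" "x \<le> t" for x
  proof -
    have "((\<lambda>x. w x \<bullet> w x) has_derivative (\<lambda>h. w x \<bullet> (h *\<^sub>R (- w x * q x)) + (h *\<^sub>R (- w x * q x)) \<bullet> w x)) (at x)"
      using der[OF that] unfolding has_vector_derivative_def
      by (intro has_derivative_inner)
    moreover have "w x \<bullet> (h *\<^sub>R (- w x * q x)) + (h *\<^sub>R (- w x * q x)) \<bullet> w x
       = (- 2 * (norm (w x))\<^sup>2 * Re (q x)) * h" for h
      unfolding cmod_power2 by (simp add: inner_complex_def algebra_simps power2_eq_square)
    ultimately have "((\<lambda>x. w x \<bullet> w x) has_derivative (*) (- 2 * (norm (w x))\<^sup>2 * Re (q x))) (at x)"
      by (auto simp: fun_eq_iff elim!: has_derivative_eq_rhs)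
    then show ?thesis
      unfolding N_def has_field_derivative_def by (simp add: dot_square_norm)
  qed
  have "N t \<le> N s"
    using assms(1)
    by (intro DERIV_nonpos_imp_nonincreasing[of s t N])
       (auto intro!: exI d mult_nonneg_nonneg simp: less_imp_le[OF pos])
  then show "norm (w t) \<le> norm (w s)"
    by (simp add: N_def)
  assume nz: "\<And>x. s \<le> x \<Longrightarrow> x \<le> t \<Longrightarrow> w x \<noteq> 0"
  have "N t < N s"
    using assms(1) by (intro DERIV_neg_imp_decreasing[of s t N])
       (auto intro!: exI d mult_pos_pos simp: pos nz)
  then show "norm (w t) < norm (w s)"
    by (simp add: N_def power2_less_imp_less)
qed

text \<open>A solution is only required to be jointly continuous, whereas the chain rule along
  characteristics asks for a jointly continuous space derivative. Cauchy's estimate converts uniform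
  closeness on a disc into closeness of derivatives at nearby points.\<close>

lemma deriv_continuous_on_param:
  fixes g :: "complex \<Rightarrow> 't::topological_space \<Rightarrow> complex"
  assumes "open S"
    and cont: "continuous_on (S \<times> A) (\<lambda>(z, t). g z t)"
    and holo: "\<And>t. t \<in> A \<Longrightarrow> (\<lambda>z. g z t) holomorphic_on S"
  shows "continuous_on (S \<times> A) (\<lambda>(z, t). deriv (\<lambda>w. g w t) z)"
  unfolding continuous_on_def
proof (clarify)
  fix z0 t0 assume z0: "z0 \<in> S" and t0: "t0 \<in> A"
  obtain r' where r': "r' > 0" "cball z0 r' \<subseteq> S"
    using \<open>open S\<close> z0 open_contains_cball by blast
  define r where "r = r' / 2"
  have r: "r > 0" "cball z0 (2 * r) \<subseteq> S"
    using r' by (auto simp: r_def)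
  have holo_deriv: "deriv (\<lambda>w. g w t0) holomorphic_on S"
    using holo[OF t0] \<open>open S\<close> by (rule holomorphic_deriv)
  have cont': "continuous_on (A \<times> cball z0 (2 * r)) (\<lambda>(t, z). g z t)"
  proof -
    have "continuous_on (A \<times> cball z0 (2 * r)) ((\<lambda>(z, t). g z t) \<circ> prod.swap)"
      by (rule continuous_on_compose)
         (use r in \<open>auto intro!: continuous_on_swap continuous_on_subset[OF cont]\<close>)
    then show ?thesis by (simp add: o_def case_prod_unfold)
  qed
  show "((\<lambda>(z, t). deriv (\<lambda>w. g w t) z) \<longlongrightarrow> deriv (\<lambda>w. g w t0) z0) (at (z0, t0) within S \<times> A)"
  proof (rule tendstoI)
    fix e :: real assume "e > 0"
    \<comment> \<open>Cauchy's estimate divides by the radius \<open>r\<close>, so the change in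
      time costs \<open>e / 4\<close>; the change in space costs less than
      \<open>e / 2\<close>.\<close>
    have "r * e / 4 > 0" using r \<open>e > 0\<close> by simp
    obtain X where X: "t0 \<in> X" "open X"
        "\<And>t z. t \<in> X \<inter> A \<Longrightarrow> z \<in> cball z0 (2 * r) \<Longrightarrow> dist (g z t) (g z t0) \<le> r * e / 4"
      using continuous_on_prod_compactE[OF cont' _ t0 \<open>r * e / 4 > 0\<close>]
      by (metis (no_types, lifting) case_prod_conv compact_cball)
    have "isCont (deriv (\<lambda>w. g w t0)) z0"
      using holo_deriv \<open>open S\<close> z0 continuous_on_eq_continuous_at holomorphic_on_imp_continuous_on
      by blast
    then have "\<forall>\<^sub>F z in nhds z0. dist (deriv (\<lambda>w. g w t0) z) (deriv (\<lambda>w. g w t0) z0) < e / 2"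
      using \<open>e > 0\<close> by (intro tendstoD) (auto simp: isCont_def tendsto_at_iff_tendsto_nhds)
    then obtain V where V: "open V" "z0 \<in> V"
        "\<And>z. z \<in> V \<Longrightarrow> dist (deriv (\<lambda>w. g w t0) z) (deriv (\<lambda>w. g w t0) z0) < e / 2"
      unfolding eventually_nhds by blast
    have "dist (deriv (\<lambda>w. g w t) z) (deriv (\<lambda>w. g w t0) z0) < e"
      if z: "z \<in> V \<inter> ball z0 r" and t: "t \<in> X \<inter> A" for z t
    proof -
      have sub: "cball z r \<subseteq> cball z0 (2 * r)"
        using z by (auto simp: cball_subset_cball_iff dist_commute)
      let ?d = "\<lambda>w. g w t - g w t0"
      have d_holo: "?d holomorphic_on S"
        using holo t t0 by (intro holomorphic_intros) auto
      have zS: "z \<in> S" using r sub by force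
      have "norm ((deriv ^^ 1) ?d z) \<le> fact 1 * (r * e / 4) / r ^ 1"
      proof (rule Cauchy_inequality)
        show "?d holomorphic_on ball z r"
          by (rule holomorphic_on_subset[OF d_holo]) (use r sub ball_subset_cball in blast)
        show "continuous_on (cball z r) ?d"
          by (rule holomorphic_on_imp_continuous_on, rule holomorphic_on_subset[OF d_holo])
             (use r sub in blast)
        show "norm (?d x) \<le> r * e / 4" if "norm (z - x) = r" for x
        proof -
          have "x \<in> cball z r" using that by (simp add: dist_norm)
          then show ?thesis using X(3)[OF t, of x] sub by (auto simp: dist_norm)
        qed
      qed (use r in auto)
      moreover have "deriv ?d z = deriv (\<lambda>w. g w t) z - deriv (\<lambda>w. g w t0) z"
        using holo t t0 zS \<open>open S\<close>
        by (intro deriv_diff) (auto intro!: holomorphic_on_imp_differentiable_at[of _ S])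
      ultimately have "dist (deriv (\<lambda>w. g w t) z) (deriv (\<lambda>w. g w t0) z) \<le> e / 4"
        using r by (simp add: dist_norm)
      then show ?thesis
        using V(3)[of z] z dist_triangle[of "deriv (\<lambda>w. g w t) z" "deriv (\<lambda>w. g w t0) z0" "deriv (\<lambda>w. g w t0) z"]
          \<open>e > 0\<close> by auto
    qed
    moreover have "open ((V \<inter> ball z0 r) \<times> X)"
      using V X by (intro open_Times open_Int) auto
    ultimately show "\<forall>\<^sub>F x in at (z0, t0) within S \<times> A.
        dist (case x of (z, t) \<Rightarrow> deriv (\<lambda>w. g w t) z) (deriv (\<lambda>w. g w t0) z0) < e"
      unfolding eventually_at_topological using V X r
      by (intro exI[of _ "(V \<inter> ball z0 r) \<times> X"]) auto
  qed
qed

text \<open>Total differentiability at a point follows from one partial derivative there and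
  continuity of the other. Continuity is taken in the holomorphic variable, where
  \<open>deriv_continuous_on_param\<close> supplies it; of the time derivative only its existence at
  the point is known.\<close>

lemma holomorphic_param_chain:
  fixes g :: "complex \<Rightarrow> real \<Rightarrow> complex" and Z :: "real \<Rightarrow> complex"
  assumes "open S" "convex S"
    and cont: "continuous_on (S \<times> A) (\<lambda>(z, t). g z t)"
    and holo: "\<And>t. t \<in> A \<Longrightarrow> (\<lambda>z. g z t) holomorphic_on S"
    and dt: "((\<lambda>s. g (Z t) s) has_vector_derivative d) (at t within A)"
    and Z: "(Z has_vector_derivative Z') (at t within B)"
    and B: "t \<in> B" "B \<subseteq> A" "Z ` B \<subseteq> S"
  shows "((\<lambda>s. g (Z s) s) has_vector_derivative d + deriv (\<lambda>w. g w t) (Z t) * Z') (at t within B)"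
proof -
  define D where "D t z = blinfun_mult_right (deriv (\<lambda>w. g w t) z)" for t z
  have Zt: "Z t \<in> S" "t \<in> A" using B by auto
  have "((\<lambda>(t, z). g z t) has_derivative (\<lambda>(ht, hz). ht *\<^sub>R d + D t (Z t) hz)) (at (t, Z t) within A \<times> S)"
  proof (rule has_derivative_partialsI)
    show "((\<lambda>x. g (Z t) x) has_derivative (\<lambda>ht. ht *\<^sub>R d)) (at t within A)"
      using dt by (simp add: has_vector_derivative_def)
    show "((\<lambda>z. g z t) has_derivative blinfun_apply (D t z)) (at z within S)" if "t \<in> A" "z \<in> S" for t z
      using holomorphic_derivI[OF holo[OF that(1)] \<open>open S\<close> that(2), of S]
      by (simp add: has_field_derivative_def D_def)
    have "continuous_on (A \<times> S) ((\<lambda>(z, t). deriv (\<lambda>w. g w t) z) \<circ> prod.swap)"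
      by (rule continuous_on_compose)
         (auto intro!: continuous_on_swap
            continuous_on_subset[OF deriv_continuous_on_param[OF \<open>open S\<close> cont holo]])
    then have "continuous_on (A \<times> S) (\<lambda>x. blinfun_mult_right (((\<lambda>(z, t). deriv (\<lambda>w. g w t) z) \<circ> prod.swap) x))"
      by (rule bounded_linear.continuous_on[OF bounded_linear_blinfun_mult_right])
    then show "continuous (at (t, Z t) within A \<times> S) (\<lambda>(t, z). D t z)"
      using Zt by (auto simp: continuous_on_eq_continuous_within D_def case_prod_unfold)
  qed (use Zt assms in auto)
  moreover have "((\<lambda>s. (s, Z s)) has_derivative (\<lambda>h. (h, h *\<^sub>R Z'))) (at t within B)"
    using Z by (auto intro!: derivative_eq_intros simp: has_vector_derivative_def)
  moreover have "(\<lambda>s. (s, Z s)) ` B \<subseteq> A \<times> S" using B by auto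
  ultimately have "((\<lambda>s. case (s, Z s) of (t, z) \<Rightarrow> g z t) has_derivative
      (\<lambda>h. case (h, h *\<^sub>R Z') of (ht, hz) \<Rightarrow> ht *\<^sub>R d + D t (Z t) hz)) (at t within B)"
    by (intro has_derivative_in_compose[where f = "\<lambda>s. (s, Z s)" and g = "\<lambda>(t, z). g z t"])
       (auto intro: has_derivative_subset)
  then show ?thesis
    by (simp add: has_vector_derivative_def D_def scaleR_add_right)
qed

text \<open>Each real derivative of the restriction is the restriction of a complex derivative,
  which is again holomorphic. Openness of \<open>S\<close> lets an identity on \<open>S\<close> be
  differentiated.\<close>

lemma smooth_curve_on_holomorphic:
  assumes F: "F holomorphic_on U" and "open U" "open S"
    and S: "\<And>t. t \<in> S \<Longrightarrow> of_real t \<in> U" "\<And>t. t \<in> S \<Longrightarrow> \<gamma> t = F (of_real t)"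
  shows "smooth_curve_on S \<gamma>"
proof -
  have step: "(h has_vector_derivative (deriv ^^ Suc m) F (of_real t)) (at t)"
    if t: "t \<in> S" and h: "\<forall>t\<in>S. h t = (deriv ^^ m) F (of_real t)" for m t and h :: "real \<Rightarrow> complex"
  proof -
    have "((deriv ^^ m) F has_field_derivative (deriv ^^ Suc m) F (of_real t)) (at (of_real t))"
      using holomorphic_derivI[OF holomorphic_higher_deriv[OF F \<open>open U\<close>] \<open>open U\<close> S(1)[OF t]]
      by simp
    from has_vector_derivative_real_field[OF this]
    show ?thesis
      by (rule has_vector_derivative_transform_within_open[OF _ \<open>open S\<close> t]) (use h in auto)
  qed
  have eq: "\<forall>t\<in>S. higher_vderiv m \<gamma> t = (deriv ^^ m) F (of_real t)" for m
  proof (induction m)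
    case 0
    then show ?case using S by (simp add: higher_vderiv_def)
  next
    case (Suc m)
    then show ?case
      using vector_derivative_at[OF step[OF _ Suc]] by (simp add: higher_vderiv_def)
  qed
  show ?thesis
    unfolding smooth_curve_on_def
    using step[OF _ eq] by (meson differentiableI_vector)
qed

text \<open>The difference divided by \<open>2 * pi\<close> is continuous and integer-valued, hence
  constant on a connected set. Through this lemma every continuous argument of a trace inherits the
  growth of one explicit argument.\<close>

lemma exp_Im_cong_constant:
  fixes \<Theta> \<Phi> :: "real \<Rightarrow> real"
  assumes "connected S" "continuous_on S \<Theta>" "continuous_on S \<Phi>"
    and "\<And>t. t \<in> S \<Longrightarrow> exp (\<i> * of_real (\<Theta> t)) = exp (\<i> * of_real (\<Phi> t))"
  obtains c where "\<And>t. t \<in> S \<Longrightarrow> \<Theta> t = \<Phi> t + c"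
proof -
  define d where "d t = (\<Theta> t - \<Phi> t) / (2 * pi)" for t
  have d_int: "\<exists>m::int. d t = of_int m" if t: "t \<in> S" for t
  proof -
    obtain m :: int where "\<i> * of_real (\<Theta> t) = \<i> * of_real (\<Phi> t) + of_int (2 * m) * pi * \<i>"
      using assms(4)[OF t] unfolding exp_eq by blast
    then have "\<Theta> t = \<Phi> t + 2 * m * pi" by (auto simp: complex_eq_iff)
    then show ?thesis by (auto simp: d_def)
  qed
  have "d constant_on S"
  proof (rule continuous_discrete_range_constant[OF \<open>connected S\<close>])
    show "continuous_on S d"
      unfolding d_def by (intro continuous_intros assms) auto
    fix x assume "x \<in> S"
    have "1 \<le> norm (d y - d x)" if "y \<in> S" "d y \<noteq> d x" for y
    proof -
      obtain m k :: int where "d y = of_int m" "d x = of_int k"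
        using d_int \<open>x \<in> S\<close> \<open>y \<in> S\<close> by meson
      then show ?thesis using that(2) by (simp flip: of_int_diff of_int_abs)
    qed
    then show "\<exists>e>0. \<forall>y. y \<in> S \<and> d y \<noteq> d x \<longrightarrow> e \<le> norm (d y - d x)"
      by (intro exI[of _ 1]) auto
  qed
  then obtain e where "\<And>t. t \<in> S \<Longrightarrow> d t = e" by (auto simp: constant_on_def)
  then have "\<Theta> t = \<Phi> t + e * (2 * pi)" if "t \<in> S" for t
    using that by (force simp: d_def field_simps)
  then show ?thesis using that by blast
qed

section \<open>The linearising map of a field of positive real part, and its image\<close>

locale spiral_flow =
  fixes p H :: "complex \<Rightarrow> complex" and b a :: real
  assumes p_holo: "p holomorphic_on ball 0 1"
    and Re_p_pos: "\<And>z. z \<in> ball 0 1 \<Longrightarrow> 0 < Re (p z)"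
    and p_zero: "p 0 = of_real b"
    and H_holo: "H holomorphic_on ball 0 1"
    and H_eq: "\<And>z. z \<in> ball 0 1 \<Longrightarrow>
      (1 + z * deriv H z) * (p z - \<i> * of_real a) = of_real b - \<i> * of_real a"
begin

definition "lam = complex_of_real b - \<i> * of_real a"
definition "phi z = z * exp (H z)"
text \<open>Off the image of the disc the values of \<open>inv_into\<close> carry no information, so
  identities for \<open>psi\<close> need membership in the image.\<close>

definition "psi = inv_into (ball 0 1) phi"

lemma b_pos: "0 < b"
  using Re_p_pos[of 0] p_zero by simp

lemma lam_simps [simp]: "Re lam = b" "Im lam = - a" "lam \<noteq> 0"
  using b_pos by (auto simp: lam_def complex_eq_iff)

lemma q_nonzero: "z \<in> ball 0 1 \<Longrightarrow> p z - \<i> * of_real a \<noteq> 0"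
  using Re_p_pos[of z] by (auto simp: complex_eq_iff)

lemma phi_holo: "phi holomorphic_on ball 0 1"
  unfolding phi_def by (intro holomorphic_intros H_holo)

lemma phi_0 [simp]: "phi 0 = 0" and phi_eq_0_iff [simp]: "phi z = 0 \<longleftrightarrow> z = 0"
  by (auto simp: phi_def)

lemma phi_deriv:
  assumes "z \<in> ball 0 1"
  shows "(phi has_field_derivative exp (H z) * (1 + z * deriv H z)) (at z)"
proof -
  have "(H has_field_derivative deriv H z) (at z)"
    using H_holo assms by (meson centre_in_ball holomorphic_derivI open_ball)
  then show ?thesis
    unfolding phi_def by (auto intro!: derivative_eq_intros simp: algebra_simps)
qed

text \<open>This says that \<open>phi\<close> carries the field \<open>- z (p z - \<i> a)\<close> to
  the linear field \<open>- lam v\<close>. The quotient-free form includes the origin.\<close>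

lemma phi_field:
  assumes "z \<in> ball 0 1"
  shows "z * deriv phi z * (p z - \<i> * of_real a) = lam * phi z"
proof -
  have "z * deriv phi z * (p z - \<i> * of_real a) =
      z * exp (H z) * ((1 + z * deriv H z) * (p z - \<i> * of_real a))"
    by (simp only: DERIV_imp_deriv[OF phi_deriv[OF assms]] mult_ac)
  then show ?thesis
    unfolding H_eq[OF assms] by (simp add: phi_def lam_def mult.commute)
qed

lemma phi_deriv_nonzero:
  assumes "z \<in> ball 0 1"
  shows "deriv phi z \<noteq> 0"
  using DERIV_imp_deriv[OF phi_deriv[OF assms]] H_eq[OF assms] lam_simps(3)
  by (auto simp: lam_def)

text \<open>In the logarithmic coordinate \<open>z = exp u\<close> the disc becomes a convex half-plane and
  spirallikeness becomes the condition that the derivative lies in a half-plane.\<close>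
lemma phi_inj: "inj_on phi (ball 0 1)"
proof -
  define U where "U = {u. Re u < 0}"
  define G where "G u = u + H (exp u)" for u
  have U_ball: "exp u \<in> ball 0 1" if "u \<in> U" for u
    using that by (simp add: U_def)
  have G_deriv: "(G has_field_derivative (1 + exp u * deriv H (exp u))) (at u)" if "u \<in> U" for u
  proof -
    have "(H has_field_derivative deriv H (exp u)) (at (exp u))"
      using H_holo U_ball[OF that] by (meson holomorphic_derivI open_ball)
    then show ?thesis
      unfolding G_def by (auto intro!: derivative_eq_intros DERIV_chain2[where f=H] simp: algebra_simps)
  qed
  \<comment> \<open>The derivative of \<open>G\<close> is \<open>lam / q\<close> with
    \<open>q = p - \<i> a\<close>; multiplication by \<open>cnj lam\<close> turns it into
    \<open>|lam|^2 / q\<close>, and inversion preserves the right half-plane.\<close>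
  have G_pos: "0 < Re (cnj lam * (1 + exp u * deriv H (exp u)))" if "u \<in> U" for u
  proof -
    let ?q = "p (exp u) - \<i> * of_real a"
    have "?q \<noteq> 0" and "0 < Re ?q" using q_nonzero Re_p_pos U_ball[OF that] by auto
    have "(1 + exp u * deriv H (exp u)) = lam / ?q"
      using H_eq[OF U_ball[OF that]] \<open>?q \<noteq> 0\<close> by (simp add: lam_def field_simps)
    then have "cnj lam * (1 + exp u * deriv H (exp u)) = of_real ((norm lam)\<^sup>2) * inverse ?q"
      by (simp only: complex_norm_square) (simp add: field_simps)
    moreover have "0 < Re (inverse ?q)"
      using \<open>0 < Re ?q\<close> by (simp add: divide_pos_pos sum_power2_gt_zero_iff)
    ultimately show ?thesis
      by (simp only: Re_complex_of_real times_complex.sel Im_complex_of_real mult_zero_left diff_zero)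
         (intro mult_pos_pos, simp_all)
  qed
  have G_inj: "inj_on G U"
    using G_deriv G_pos
    by (rule Re_pos_deriv_inj_on[rotated]) (auto simp: U_def convex_halfspace_Re_lt)
  have phi_G: "phi (exp u) = exp (G u)" for u
    by (simp add: phi_def G_def exp_add)
  show ?thesis
  proof (rule inj_onI)
    fix z w assume zw: "z \<in> ball 0 1" "w \<in> ball 0 1" "phi z = phi w"
    show "z = w"
    proof (cases "z = 0")
      case True
      then show ?thesis using zw phi_eq_0_iff[of w] by simp
    next
      case False
      then have "w \<noteq> 0" using zw phi_eq_0_iff[of z] by auto
      define u v where "u = Ln z" and "v = Ln w"
      have uv: "exp u = z" "exp v = w" "u \<in> U" "v \<in> U"
        using zw False \<open>w \<noteq> 0\<close> by (auto simp: u_def v_def U_def Re_Ln)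
      then have "exp (G u) = exp (G v)"
        using zw phi_G by metis
      then obtain m :: int where m: "G u = G v + of_int (2 * m) * pi * \<i>"
        by (auto simp: exp_eq)
      \<comment> \<open>Equal exponentials determine \<open>G u\<close> only up to a period. Moving
        \<open>v\<close> by that period changes neither \<open>exp v\<close> nor its real part, so
        \<open>v'\<close> stays in \<open>U\<close> and \<open>G v'\<close> absorbs the
        difference.\<close>
      define v' where "v' = v + of_int (2 * m) * pi * \<i>"
      have "exp v' = exp v" unfolding v'_def exp_eq by blast
      then have "G u = G v'"
        using m by (simp add: G_def v'_def)
      moreover have "v' \<in> U" using uv by (simp add: U_def v'_def)
      ultimately have "u = v'" using G_inj uv by (auto dest: inj_onD)
      then show ?thesis using uv \<open>exp v' = exp v\<close> by simp
    qed
  qed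
qed

lemma phi_open: "open (phi ` ball 0 1)"
  by (rule open_mapping_thm3[OF phi_holo _ phi_inj]) auto

lemma psi_phi [simp]: "z \<in> ball 0 1 \<Longrightarrow> psi (phi z) = z"
  unfolding psi_def using phi_inj by simp

lemma phi_psi: "v \<in> phi ` ball 0 1 \<Longrightarrow> phi (psi v) = v"
  and psi_in: "v \<in> phi ` ball 0 1 \<Longrightarrow> psi v \<in> ball 0 1"
  by auto

lemma psi_deriv:
  assumes "v \<in> phi ` ball 0 1"
  shows "(psi has_field_derivative inverse (deriv phi (psi v))) (at v)"
proof -
  obtain g where g: "g holomorphic_on phi ` ball 0 1"
      "\<And>z. z \<in> ball 0 1 \<Longrightarrow> deriv phi z * deriv g (phi z) = 1"
      "\<And>z. z \<in> ball 0 1 \<Longrightarrow> g (phi z) = z"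
    using holomorphic_has_inverse[OF phi_holo _ phi_inj] by blast
  have "(g has_field_derivative deriv g v) (at v)"
    using g(1) assms phi_open by (meson holomorphic_derivI)
  then have "(psi has_field_derivative deriv g v) (at v)"
    using assms phi_open g(3)
    by (elim has_field_derivative_transform_within_open) auto
  moreover have "deriv g v = inverse (deriv phi (psi v))"
    using g(2)[OF psi_in[OF assms]] by (simp add: phi_psi[OF assms] inverse_unique)
  ultimately show ?thesis by simp
qed

lemma psi_holo: "psi holomorphic_on phi ` ball 0 1"
  using psi_deriv phi_open by (auto simp: holomorphic_on_open)

text \<open>By \<open>phi_field\<close>, \<open>psi\<close> turns linear decay into motion along the
  field. Time is complex here, so that it can later be reversed by the ordinary complex chain
  rule.\<close>

lemma trajectory_deriv:
  assumes "C * exp (- lam * s) \<in> phi ` ball 0 1"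
  shows "((\<lambda>s. psi (C * exp (- lam * s))) has_field_derivative
     - psi (C * exp (- lam * s)) * (p (psi (C * exp (- lam * s))) - \<i> * of_real a)) (at s)"
proof -
  let ?v = "C * exp (- lam * s)"
  have "((\<lambda>s. psi (C * exp (- lam * s))) has_field_derivative
      inverse (deriv phi (psi ?v)) * (- lam * ?v)) (at s)"
    by (rule DERIV_chain2[where g = "\<lambda>s. C * exp (- lam * s)", OF psi_deriv[OF assms]])
      (auto intro!: derivative_eq_intros)
  moreover have "inverse (deriv phi (psi ?v)) * (- lam * ?v) = - psi ?v * (p (psi ?v) - \<i> * of_real a)"
    using phi_field[OF psi_in[OF assms]] phi_deriv_nonzero[OF psi_in[OF assms]]
    unfolding phi_psi[OF assms] by (simp add: field_simps)
  ultimately show ?thesis by simp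
qed

lemma trajectory_vector_deriv:
  fixes s :: real
  assumes "C * exp (- lam * of_real s) \<in> phi ` ball 0 1"
  shows "((\<lambda>s. psi (C * exp (- lam * of_real s))) has_vector_derivative
     - psi (C * exp (- lam * of_real s)) * (p (psi (C * exp (- lam * of_real s))) - \<i> * of_real a)) (at s)"
  using has_vector_derivative_real_field[OF trajectory_deriv[OF assms]] by (simp add: o_def)

text \<open>Continuation argument: the compact set \<open>K\<close> makes the set of good times
  closed, so there is a last one, \<open>m\<close>. If \<open>m < t\<close>, openness of the image
  keeps the curve inside a little longer, and there the modulus cannot grow, so the curve is still
  in \<open>K\<close>, contradicting maximality.\<close>

lemma spiral_invariant:
  assumes v: "v \<in> phi ` ball 0 1" and "0 \<le> t"
  shows "v * exp (- lam * of_real t) \<in> phi ` ball 0 1"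
proof -
  define r where "r = norm (psi v)"
  define K where "K = phi ` cball 0 r"
  have r: "r < 1" using psi_in[OF v] by (simp add: r_def)
  then have sub: "cball 0 r \<subseteq> (ball 0 1 :: complex set)" by auto
  have "closed K" unfolding K_def
    using sub holomorphic_on_imp_continuous_on[OF phi_holo]
    by (intro compact_imp_closed compact_continuous_image) (auto intro: continuous_on_subset)
  define S where "S = {s \<in> {0..t}. v * exp (- lam * of_real s) \<in> K}"
  have cont: "continuous_on UNIV (\<lambda>s::real. v * exp (- lam * of_real s))"
    by (intro continuous_intros)
  have "S = {0..t} \<inter> (\<lambda>s. v * exp (- lam * of_real s)) -` K"
    by (auto simp: S_def)
  moreover have "closed ((\<lambda>s::real. v * exp (- lam * of_real s)) -` K)"
    using \<open>closed K\<close> cont by (simp add: continuous_closed_vimage continuous_on_eq_continuous_at)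
  ultimately have "compact S" by (simp add: compact_Int_closed)
  moreover have "0 \<in> S"
  proof -
    have "phi (psi v) \<in> K" by (simp add: K_def r_def del: phi_psi)
    then show ?thesis using \<open>0 \<le> t\<close> by (simp add: S_def phi_psi[OF v])
  qed
  ultimately obtain m where m: "m \<in> S" "\<And>s. s \<in> S \<Longrightarrow> s \<le> m"
    using compact_attains_sup[of S] by blast
  have K_sub: "K \<subseteq> phi ` ball 0 1" using sub by (auto simp: K_def)
  have "m = t"
  proof (rule ccontr)
    assume "m \<noteq> t"
    with m have "m < t" "0 \<le> m" by (auto simp: S_def)
    have "open ((\<lambda>s::real. v * exp (- lam * of_real s)) -` (phi ` ball 0 1))"
      using phi_open cont by (rule open_vimage)
    moreover have "m \<in> (\<lambda>s::real. v * exp (- lam * of_real s)) -` (phi ` ball 0 1)"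
      using m K_sub by (auto simp: S_def)
    ultimately obtain e where e: "e > 0"
        "\<And>s::real. \<bar>s - m\<bar> < e \<Longrightarrow> v * exp (- lam * of_real s) \<in> phi ` ball 0 1"
      unfolding open_dist dist_real_def by (metis vimageD)
    define s where "s = min t (m + e / 2)"
    have s: "m < s" "s \<le> t" "\<And>x. m \<le> x \<Longrightarrow> x \<le> s \<Longrightarrow> \<bar>x - m\<bar> < e"
      using \<open>m < t\<close> e by (auto simp: s_def)
    let ?w = "\<lambda>s::real. psi (v * exp (- lam * of_real s))"
    have "norm (?w s) \<le> norm (?w m)"
    proof (rule norm_antimono_of_field(1)[OF s(1), of ?w "\<lambda>s. p (?w s) - \<i> * of_real a"])
      fix x assume x: "m \<le> x" "x \<le> s"
      then have im: "v * exp (- lam * of_real x) \<in> phi ` ball 0 1" using e s by blast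
      show "(?w has_vector_derivative - ?w x * (p (?w x) - \<i> * of_real a)) (at x)"
        using trajectory_vector_deriv[OF im] by simp
      show "0 < Re (p (?w x) - \<i> * of_real a)"
        using Re_p_pos[OF psi_in[OF im]] by simp
    qed
    also have "norm (?w m) \<le> r"
    proof -
      obtain z where "z \<in> cball 0 r" "v * exp (- lam * of_real m) = phi z"
        using m by (auto simp: S_def K_def)
      then show ?thesis using sub by (auto simp: subset_iff)
    qed
    finally have "?w s \<in> cball 0 r" by simp
    moreover have "v * exp (- lam * of_real s) = phi (?w s)"
      using phi_psi e s by (metis less_eq_real_def order_refl)
    ultimately have "s \<in> S"
      using s \<open>0 \<le> m\<close> unfolding S_def K_def by auto
    then show False using m(2) s by force
  qed
  then show ?thesis using m K_sub by (auto simp: S_def)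
qed

text \<open>Only the argument of \<open>lam\<close> matters: its modulus \<open>c\<close> merely
  rescales the time along the spirals.\<close>

lemma spirallike_phi:
  assumes "exp (\<i> * of_real \<theta>) * of_real c = lam" "c > 0"
  shows "spirallike \<theta> phi"
proof -
  have "phi ` ball 0 1 homeomorphic (ball 0 1 :: complex set)"
    by (rule homeomorphic_sym[THEN iffD1], rule homeomorphicI[where g = psi])
       (auto intro: holomorphic_on_imp_continuous_on phi_holo psi_holo simp: psi_in image_image)
  then have "simply_connected (phi ` ball 0 1)"
    using homeomorphic_simply_connected_eq convex_imp_simply_connected convex_ball by blast
  moreover have "w0 * exp (- exp (\<i> * of_real \<theta>) * of_real s) \<in> phi ` ball 0 1"
    if "w0 \<in> phi ` ball 0 1" "s \<ge> 0" for w0 and s :: real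
  proof -
    have "exp (\<i> * of_real \<theta>) * of_real s = lam * of_real (s / c)"
      using assms(1)[symmetric] assms(2) by simp
    then show ?thesis
      using spiral_invariant[OF that(1), of "s / c"] that assms(2) by simp
  qed
  moreover have "0 \<in> phi ` ball 0 1" by (rule image_eqI[of _ _ 0]) auto
  ultimately show ?thesis
    unfolding spirallike_def spirallike_domain_def
    using phi_open phi_inj phi_holo by auto
qed

section \<open>The solution of the evolution equation and its uniqueness\<close>

definition "flow z t = psi (exp (- lam * of_real t) * phi (exp (- \<i> * of_real (a * t)) * z))"

lemma rot_in_ball [simp]: "exp (- \<i> * of_real (a * t)) * z \<in> ball 0 1 \<longleftrightarrow> z \<in> ball 0 1"
  "exp (- (\<i> * (of_real a * of_real t))) * z \<in> ball 0 1 \<longleftrightarrow> z \<in> ball 0 1"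
  by (auto simp: norm_mult)

lemma flow_arg_in:
  assumes "z \<in> ball 0 1" "0 \<le> t"
  shows "exp (- lam * of_real t) * phi (exp (- \<i> * of_real (a * t)) * z) \<in> phi ` ball 0 1"
  using spiral_invariant[of "phi (exp (- \<i> * of_real (a * t)) * z)" t] assms
  by (metis imageI mult.commute rot_in_ball(1))

lemma flow_0 [simp]: "z \<in> ball 0 1 \<Longrightarrow> flow z 0 = z"
  by (simp add: flow_def)

lemma flow_deriv_space:
  assumes "z \<in> ball 0 1" "0 \<le> t"
  shows "((\<lambda>z. flow z t) has_field_derivative
     inverse (deriv phi (flow z t)) * exp (- lam * of_real t) *
     deriv phi (exp (- \<i> * of_real (a * t)) * z) * exp (- \<i> * of_real (a * t))) (at z)"
proof -
  let ?w = "exp (- \<i> * of_real (a * t)) * z"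
  have "(phi has_field_derivative deriv phi ?w) (at ?w)"
    using assms by (intro holomorphic_derivI[OF phi_holo]) (auto simp: norm_mult)
  then have "((\<lambda>z. exp (- lam * of_real t) * phi (exp (- \<i> * of_real (a * t)) * z)) has_field_derivative
     exp (- lam * of_real t) * (deriv phi ?w * exp (- \<i> * of_real (a * t)))) (at z)"
    by (intro DERIV_cmult DERIV_chain2[where f = phi]) (auto intro!: derivative_eq_intros)
  from DERIV_chain2[where f = psi, OF psi_deriv this] flow_arg_in[OF assms]
  show ?thesis unfolding flow_def by (simp add: mult.assoc)
qed

text \<open>Differentiating the rotated argument contributes a term in \<open>- \<i> a\<close>,
  which cancels the \<open>\<i> a\<close> hidden in \<open>lam * phi\<close> by
  \<open>phi_field\<close>. What is left is \<open>p\<close> times the derivative produced by moving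
  \<open>z\<close>, which is the equation.\<close>

lemma flow_deriv_time:
  assumes "z \<in> ball 0 1" "0 \<le> t"
  shows "((\<lambda>t. flow z t) has_vector_derivative
     - deriv (\<lambda>w. flow w t) z * z * p (exp (- \<i> * of_real (a * t)) * z)) (at t within X)"
proof -
  let ?w = "\<lambda>t. exp (- \<i> * (of_real a * t)) * z"
  define V where "V t = exp (- lam * t) * phi (?w t)" for t
  have w: "?w (of_real t) \<in> ball 0 1" using assms by (simp add: norm_mult)
  have V_in: "V (of_real t) \<in> phi ` ball 0 1"
    using flow_arg_in[OF assms] by (simp add: V_def)
  have "(phi has_field_derivative deriv phi (?w (of_real t))) (at (?w (of_real t)))"
    using assms by (intro holomorphic_derivI[OF phi_holo]) (auto simp: norm_mult)
  then have "(V has_field_derivative - lam * V (of_real t) +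
     exp (- lam * of_real t) * deriv phi (?w (of_real t)) * (- \<i> * of_real a * ?w (of_real t))) (at (of_real t))"
    unfolding V_def
    by (auto intro!: derivative_eq_intros DERIV_chain2[where f = phi] simp: algebra_simps)
  from DERIV_chain2[where f = psi, OF psi_deriv[OF V_in] this]
  have "((\<lambda>t. psi (V t)) has_field_derivative inverse (deriv phi (psi (V (of_real t)))) *
     (- lam * V (of_real t) +
     exp (- lam * of_real t) * deriv phi (?w (of_real t)) * (- \<i> * of_real a * ?w (of_real t)))) (at (of_real t))" .
  moreover have "- lam * V (of_real t) +
     exp (- lam * of_real t) * deriv phi (?w (of_real t)) * (- \<i> * of_real a * ?w (of_real t))
     = - (exp (- lam * of_real t) * deriv phi (?w (of_real t)) * ?w (of_real t) * p (?w (of_real t)))"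
  proof -
    have "lam * V (of_real t) = exp (- lam * of_real t) * (lam * phi (?w (of_real t)))"
      by (simp add: V_def)
    also have "\<dots> = exp (- lam * of_real t) * (?w (of_real t) * deriv phi (?w (of_real t)) * (p (?w (of_real t)) - \<i> * of_real a))"
      using phi_field[OF w] by simp
    finally show ?thesis by (simp add: algebra_simps)
  qed
  moreover have "deriv (\<lambda>w. flow w t) z * z = inverse (deriv phi (psi (V (of_real t)))) *
      (exp (- lam * of_real t) * deriv phi (?w (of_real t)) * ?w (of_real t))"
    using DERIV_imp_deriv[OF flow_deriv_space[OF assms]] by (simp add: flow_def V_def mult_ac)
  ultimately have "((\<lambda>t. psi (V t)) has_field_derivative
     - deriv (\<lambda>w. flow w t) z * z * p (exp (- \<i> * of_real (a * t)) * z)) (at (of_real t))"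
    by (simp only: mult_minus_left mult_minus_right mult.assoc of_real_mult)
  from has_vector_derivative_real_field[OF this]
  show ?thesis unfolding flow_def V_def by (simp add: o_def has_vector_derivative_at_within)
qed

lemma flow_holo: "0 \<le> t \<Longrightarrow> (\<lambda>z. flow z t) holomorphic_on ball 0 1"
  using flow_deriv_space by (meson holomorphic_on_open open_ball)

lemma flow_continuous: "continuous_on (ball 0 1 \<times> {0..}) (\<lambda>(z, t). flow z t)"
proof -
  have "continuous_on (ball 0 1 \<times> {0..}) (\<lambda>x. exp (- lam * of_real (snd x)) *
      phi (exp (- \<i> * of_real (a * snd x)) * fst x))"
    by (intro continuous_intros continuous_on_compose2[OF holomorphic_on_imp_continuous_on[OF phi_holo]])
       (auto simp: norm_mult)
  then show ?thesis unfolding flow_def case_prod_unfold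
    by (rule continuous_on_compose2[OF holomorphic_on_imp_continuous_on[OF psi_holo]])
       (use flow_arg_in in auto)
qed

text \<open>Method of characteristics. \<open>C\<close> is the end point \<open>flow z T\<close> in
  the linear coordinate, and \<open>w\<close> follows the field backwards in time from it, reaching
  the rotated point \<open>z\<close> at time \<open>T\<close>. Every solution is constant along
  \<open>Z\<close>, so its value at \<open>(z, T)\<close> is the initial value at
  \<open>Z 0 = flow z T\<close>.\<close>

lemma flow_unique:
  fixes g :: "complex \<Rightarrow> real \<Rightarrow> complex"
  assumes g_cont: "continuous_on (ball 0 1 \<times> {0..}) (\<lambda>(z, t). g z t)"
    and g_holo: "\<And>t. t \<ge> 0 \<Longrightarrow> (\<lambda>z. g z t) holomorphic_on ball 0 1"
    and g_0: "\<And>z. z \<in> ball 0 1 \<Longrightarrow> g z 0 = z"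
    and g_t: "\<And>z t. z \<in> ball 0 1 \<Longrightarrow> t \<ge> 0 \<Longrightarrow> ((\<lambda>s. g z s) has_vector_derivative
        - deriv (\<lambda>w. g w t) z * z * p (exp (- \<i> * of_real (a * t)) * z)) (at t within {0..})"
    and z: "z \<in> ball 0 1" and T: "T \<ge> 0"
  shows "g z T = flow z T"
proof -
  define C where "C = exp (- lam * of_real T) * phi (exp (- \<i> * of_real (a * T)) * z)"
  define w where "w s = psi (C * exp (- lam * of_real (- s)))" for s :: real
  \<comment> \<open>The characteristic through \<open>(z, T)\<close>.\<close>
  define Z where "Z s = exp (\<i> * of_real (a * s)) * w s" for s :: real
  have im: "C * exp (- lam * of_real (- s)) \<in> phi ` ball 0 1" if "s \<in> {0..T}" for s :: real
  proof -
    have "C * exp (- lam * of_real (- s)) = phi (exp (- \<i> * of_real (a * T)) * z) * exp (- lam * of_real (T - s))"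
      by (simp add: C_def algebra_simps flip: exp_add)
    also have "\<dots> \<in> phi ` ball 0 1"
      using that z by (intro spiral_invariant imageI) (auto simp: norm_mult)
    finally show ?thesis .
  qed
  have w_in: "w s \<in> ball 0 1" if "s \<in> {0..T}" for s
    unfolding w_def using psi_in[OF im[OF that]] .
  then have Z_in: "Z s \<in> ball 0 1" if "s \<in> {0..T}" for s
    using that by (auto simp: Z_def norm_mult)
  have w_Z: "exp (- \<i> * of_real (a * s)) * Z s = w s" for s
    by (simp add: Z_def mult.assoc[symmetric] flip: exp_add)
  have Z_deriv: "(Z has_vector_derivative Z s * p (w s)) (at s)" if "s \<in> {0..T}" for s
  proof -
    have "((\<lambda>s. psi (C * exp (- lam * - s))) has_field_derivative
        w s * (p (w s) - \<i> * of_real a)) (at (of_real s))"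
      using DERIV_chain2[where g = uminus and x = "of_real s" and s = UNIV and Db = "-1",
          OF trajectory_deriv[of C "- of_real s"]] im[OF that]
      by (simp add: w_def DERIV_minus[OF DERIV_ident])
    then have "((\<lambda>s. exp (\<i> * (of_real a * s)) * psi (C * exp (- lam * - s))) has_field_derivative
        Z s * p (w s)) (at (of_real s))"
      by (auto intro!: derivative_eq_intros simp: Z_def w_def algebra_simps)
    from has_vector_derivative_real_field[OF this] show ?thesis
      by (simp add: Z_def[abs_def] w_def[abs_def] o_def)
  qed
  \<comment> \<open>The time derivative given by the equation and the transport term along
    \<open>Z\<close> cancel exactly.\<close>
  have "((\<lambda>s. g (Z s) s) has_vector_derivative 0) (at s within {0..T})" if "s \<in> {0..T}" for s
  proof -
    have "((\<lambda>s. g (Z s) s) has_vector_derivative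
        (- deriv (\<lambda>w. g w s) (Z s) * Z s * p (exp (- \<i> * of_real (a * s)) * Z s))
        + deriv (\<lambda>w. g w s) (Z s) * (Z s * p (w s))) (at s within {0..T})"
      by (rule holomorphic_param_chain[OF _ _ g_cont g_holo g_t])
         (use that Z_in has_vector_derivative_at_within[OF Z_deriv] in auto)
    then show ?thesis unfolding w_Z by (simp add: algebra_simps)
  qed
  then obtain c where c: "\<And>s. s \<in> {0..T} \<Longrightarrow> g (Z s) s = c"
    using has_vector_derivative_zero_constant[of "{0..T}" "\<lambda>s. g (Z s) s"] by auto
  have "Z T = z"
  proof -
    have "C * exp (- lam * of_real (- T)) = phi (exp (- \<i> * of_real (a * T)) * z)"
      by (simp add: C_def exp_minus)
    then have "w T = exp (- \<i> * of_real (a * T)) * z"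
      unfolding w_def using z by (simp only: psi_phi rot_in_ball)
    then show ?thesis by (simp add: Z_def mult.assoc[symmetric] flip: exp_add)
  qed
  moreover have "Z 0 = flow z T"
    by (simp add: Z_def w_def C_def flow_def)
  ultimately show ?thesis
    using c[of 0] c[of T] T g_0[of "Z 0"] Z_in[of 0] by auto
qed

section \<open>Decay, smoothness and winding of trajectories\<close>

lemma trajectory_tendsto_0:
  shows "((\<lambda>t::real. psi (C * exp (- lam * of_real t))) \<longlongrightarrow> 0) at_top"
proof -
  have lim0: "((\<lambda>t::real. C * exp (- lam * of_real t)) \<longlongrightarrow> 0) at_top"
  proof (rule tendsto_norm_zero_cancel)
    have "((\<lambda>t. norm C * exp (- b * t)) \<longlongrightarrow> norm C * 0) at_top"
      using b_pos
      by (intro tendsto_intros filterlim_compose[OF exp_at_bot]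
           filterlim_tendsto_neg_mult_at_bot[OF tendsto_const] filterlim_ident) auto
    then show "((\<lambda>t::real. norm (C * exp (- lam * of_real t))) \<longlongrightarrow> 0) at_top"
      by (simp add: norm_mult)
  qed
  \<comment> \<open>The origin is an interior point of the image, so continuity of
    \<open>psi\<close> there handles any \<open>C\<close>: only large times count.\<close>
  have "0 \<in> phi ` ball 0 1" by (rule image_eqI[of _ _ 0]) auto
  from DERIV_isCont[OF psi_deriv[OF this]] have "isCont psi 0" .
  moreover have "psi 0 = 0" using psi_phi[of 0] by simp
  ultimately show ?thesis using isCont_tendsto_compose[OF _ lim0, of psi] by simp
qed

text \<open>Only positive times are constrained, because for a trace \<open>C\<close> is merely a
  boundary limit of \<open>phi\<close>. Thus the facts below apply to curves that start on the unit
  circle.\<close>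

context
  fixes C :: complex and w :: "real \<Rightarrow> complex"
  assumes C_nz: "C \<noteq> 0"
    and C_in: "\<And>t. t > 0 \<Longrightarrow> C * exp (- lam * of_real t) \<in> phi ` ball 0 1"
    and w_eq: "\<And>t. t > 0 \<Longrightarrow> w t = psi (C * exp (- lam * of_real t))"
begin

lemma traj_in: "t > 0 \<Longrightarrow> w t \<in> ball 0 1"
  and traj_phi: "t > 0 \<Longrightarrow> phi (w t) = C * exp (- lam * of_real t)"
  using psi_in[OF C_in] phi_psi[OF C_in] by (auto simp: w_eq)

lemma traj_nz: "t > 0 \<Longrightarrow> w t \<noteq> 0"
  using traj_phi[of t] C_nz phi_eq_0_iff[of "w t"] by auto

lemma traj_deriv:
  assumes "t > 0"
  shows "(w has_vector_derivative - w t * (p (w t) - \<i> * of_real a)) (at t)"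
  by (rule has_vector_derivative_transform_within_open[OF
      trajectory_vector_deriv[OF C_in[OF assms], folded w_eq[OF assms]], of "{0<..}"])
     (use assms in \<open>auto simp: w_eq\<close>)

lemma traj_norm_less:
  assumes "0 < s" "s < t"
  shows "norm (w t) < norm (w s)"
proof (rule norm_antimono_of_field(2)[OF assms(2)])
  fix x assume "s \<le> x" "x \<le> t"
  then have x: "x > 0" using assms by simp
  show "(w has_vector_derivative - w x * (p (w x) - \<i> * of_real a)) (at x)" by (rule traj_deriv[OF x])
  show "0 < Re (p (w x) - \<i> * of_real a)" using Re_p_pos[OF traj_in[OF x]] by simp
  show "w x \<noteq> 0" by (rule traj_nz[OF x])
qed

lemma traj_tendsto_0: "(w \<longlongrightarrow> 0) at_top"
  using trajectory_tendsto_0[of C]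
  by (rule Lim_transform_eventually) (auto simp: eventually_at_top_dense w_eq intro!: exI[of _ 0])

lemma traj_smooth: "smooth_curve_on {0<..} w"
proof (rule smooth_curve_on_holomorphic)
  show "open ((\<lambda>s. C * exp (- lam * s)) -` (phi ` ball 0 1))"
    by (intro open_vimage phi_open continuous_intros)
  show "(\<lambda>s. psi (C * exp (- lam * s))) holomorphic_on ((\<lambda>s. C * exp (- lam * s)) -` (phi ` ball 0 1))"
    by (rule holomorphic_on_compose_gen[where g = psi, unfolded o_def, OF _ psi_holo])
       (auto intro!: holomorphic_intros)
qed (use C_in w_eq in auto)

text \<open>Solving \<open>w * exp (H w) = C * exp (- lam * t)\<close> for the logarithm of
  \<open>w\<close> gives a continuous one without choosing a branch along the curve; its imaginary
  part is \<open>a * t\<close> up to a term that converges.\<close>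

definition "traj_log t = Ln C - lam * of_real t - H (w t)"

lemma traj_log_exp: "t > 0 \<Longrightarrow> exp (traj_log t) = w t"
  using traj_phi[of t] C_nz by (simp add: traj_log_def exp_diff exp_minus exp_add phi_def field_simps)

lemma traj_log_deriv:
  assumes "t > 0"
  shows "(traj_log has_vector_derivative - (p (w t) - \<i> * of_real a)) (at t)"
proof -
  let ?q = "p (w t) - \<i> * of_real a"
  have "(H has_field_derivative deriv H (w t)) (at (w t))"
    using H_holo traj_in[OF assms] by (intro holomorphic_derivI) auto
  from field_vector_diff_chain_at[OF traj_deriv[OF assms] this]
  have "((\<lambda>t. H (w t)) has_vector_derivative (- w t * ?q) * deriv H (w t)) (at t)"
    by (simp add: o_def)
  then have "((\<lambda>t. Ln C - lam * of_real t - H (w t)) has_vector_derivative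
     0 - lam * 1 - (- w t * ?q) * deriv H (w t)) (at t)"
    by (intro has_vector_derivative_diff has_vector_derivative_const has_vector_derivative_mult_right)
       (auto simp: has_vector_derivative_def intro!: derivative_eq_intros simp: scaleR_conv_of_real)
  moreover have "0 - lam * 1 - (- w t * ?q) * deriv H (w t) = - ?q"
  proof -
    have "lam = ?q + w t * deriv H (w t) * ?q"
      using H_eq[OF traj_in[OF assms]] by (simp add: lam_def algebra_simps)
    then show ?thesis by (simp add: algebra_simps)
  qed
  ultimately show ?thesis by (simp add: traj_log_def[abs_def])
qed

text \<open>The angular speed is \<open>a - Im (p (w t))\<close>. It tends to \<open>a\<close>,
  since \<open>w\<close> tends to 0 and \<open>p 0 = b\<close> is real; this gives eventual
  monotonicity. Divergence follows from the explicit form of \<open>traj_log\<close>, in which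
  \<open>H (w t)\<close> converges.\<close>

lemma traj_spirals:
  assumes "a \<noteq> 0" and cont: "continuous_on {0..} \<Theta>"
    and pol: "\<And>t. t \<ge> 0 \<Longrightarrow> w t = of_real (norm (w t)) * exp (\<i> * of_real (\<Theta> t))"
  shows "\<exists>T. strict_mono_on {T..} (\<lambda>t. sgn a * \<Theta> t)"
    and "filterlim (\<lambda>t. sgn a * \<Theta> t) at_top at_top"
proof -
  have "continuous_on {0<..} traj_log"
    using traj_log_deriv by (auto intro!: continuous_at_imp_continuous_on has_vector_derivative_continuous)
  then have cont_Im: "continuous_on {0<..} (\<lambda>t. Im (traj_log t))"
    by (intro continuous_intros)
  obtain c where c: "\<And>t. t \<in> {0<..} \<Longrightarrow> \<Theta> t = Im (traj_log t) + c"
  proof (rule exp_Im_cong_constant[of "{0<..}" \<Theta> "\<lambda>t. Im (traj_log t)"])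
    fix t :: real assume t: "t \<in> {0<..}"
    have "w t = of_real (exp (Re (traj_log t))) * exp (\<i> * of_real (Im (traj_log t)))"
      using traj_log_exp[of t] t exp_eq_polar[of "traj_log t"] by (simp add: cis_conv_exp)
    moreover have "norm (w t) = exp (Re (traj_log t))"
      using traj_log_exp[of t] t by (metis greaterThan_iff norm_exp_eq_Re)
    ultimately show "exp (\<i> * of_real (\<Theta> t)) = exp (\<i> * of_real (Im (traj_log t)))"
      using pol[of t] t by (metis exp_not_eq_zero greaterThan_iff less_eq_real_def mult_left_cancel of_real_eq_0_iff)
  qed (use cont cont_Im in \<open>auto intro: continuous_on_subset\<close>)
  have isCont0: "isCont p 0" "isCont H 0"
    using p_holo H_holo by (auto intro!: continuous_on_interior[OF holomorphic_on_imp_continuous_on])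
  have "((\<lambda>t. Im (p (w t))) \<longlongrightarrow> Im (p 0)) at_top"
    by (intro tendsto_Im isCont_tendsto_compose[OF isCont0(1) traj_tendsto_0])
  then have "((\<lambda>t. \<bar>a\<bar> - sgn a * Im (p (w t))) \<longlongrightarrow> \<bar>a\<bar> - sgn a * Im (p 0)) at_top"
    by (intro tendsto_diff tendsto_mult tendsto_const)
  then have "\<forall>\<^sub>F t in at_top. \<bar>a\<bar> - sgn a * Im (p (w t)) > 0"
    using \<open>a \<noteq> 0\<close> by (intro order_tendstoD(1)[where y = "\<bar>a\<bar> - sgn a * Im (p 0)"]) (auto simp: p_zero)
  then obtain T0 where T0: "\<And>t. t \<ge> T0 \<Longrightarrow> \<bar>a\<bar> - sgn a * Im (p (w t)) > 0"
    by (auto simp: eventually_at_top_linorder)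
  define T where "T = max T0 1"
  have "strict_mono_on {T..} (\<lambda>t. sgn a * \<Theta> t)"
  proof (rule strict_mono_onI)
    fix s t assume st: "s \<in> {T..}" "t \<in> {T..}" "s < t"
    have "sgn a * Im (traj_log s) < sgn a * Im (traj_log t)"
    proof (rule DERIV_pos_imp_increasing[OF st(3)])
      fix x assume x: "s \<le> x" "x \<le> t"
      then have x0: "x > 0" "x \<ge> T0" using st by (auto simp: T_def)
      have "((\<lambda>t. Im (traj_log t)) has_vector_derivative Im (- (p (w x) - \<i> * of_real a))) (at x)"
        by (rule bounded_linear.has_vector_derivative[OF bounded_linear_Im traj_log_deriv[OF x0(1)]])
      then have "((\<lambda>t. Im (traj_log t)) has_real_derivative a - Im (p (w x))) (at x)"
        by (simp add: has_real_derivative_iff_has_vector_derivative)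
      from DERIV_cmult[OF this, of "sgn a"]
      have "((\<lambda>t. sgn a * Im (traj_log t)) has_real_derivative \<bar>a\<bar> - sgn a * Im (p (w x))) (at x)"
        by (simp add: right_diff_distrib abs_sgn mult.commute)
      then show "\<exists>y. ((\<lambda>t. sgn a * Im (traj_log t)) has_real_derivative y) (at x) \<and> 0 < y"
        using T0[OF x0(2)] by blast
    qed
    moreover have "s > 0" "t > 0" using st by (auto simp: T_def)
    ultimately show "sgn a * \<Theta> s < sgn a * \<Theta> t"
      by (simp add: c algebra_simps)
  qed
  then show "\<exists>T. strict_mono_on {T..} (\<lambda>t. sgn a * \<Theta> t)" by blast
  have "filterlim (\<lambda>t. sgn a * (Im (Ln C) - Im (H (w t)) + c) + \<bar>a\<bar> * t) at_top at_top"
  proof (rule filterlim_tendsto_add_at_top)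
    show "((\<lambda>t. sgn a * (Im (Ln C) - Im (H (w t)) + c)) \<longlongrightarrow> sgn a * (Im (Ln C) - Im (H 0) + c)) at_top"
      by (intro tendsto_intros isCont_tendsto_compose[OF isCont0(2) traj_tendsto_0])
    show "filterlim (\<lambda>t. \<bar>a\<bar> * t) at_top at_top"
      using \<open>a \<noteq> 0\<close>
      by (intro filterlim_tendsto_pos_mult_at_top[OF tendsto_const] filterlim_ident) auto
  qed
  moreover have "\<forall>\<^sub>F t in at_top. sgn a * (Im (Ln C) - Im (H (w t)) + c) + \<bar>a\<bar> * t = sgn a * \<Theta> t"
    using eventually_gt_at_top[of 0]
    by eventually_elim (auto simp: c traj_log_def algebra_simps abs_sgn)
  ultimately show "filterlim (\<lambda>t. sgn a * \<Theta> t) at_top at_top"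
    by (rule filterlim_mono_eventually[OF _ order_refl order_refl])
qed

end

section \<open>Traces starting at a pole of \<open>p\<close>\<close>

lemma boundary_trace:
  assumes \<zeta>: "norm \<zeta> = 1" and r: "0 < r" and q_holo: "q holomorphic_on ball \<zeta> r"
    and q0: "q \<zeta> = 0" and \<kappa>: "0 < \<kappa>" "deriv q \<zeta> * \<zeta> = - of_real \<kappa>"
    and C: "C \<noteq> 0"
    and phi_q: "\<And>z. z \<in> ball 0 1 \<inter> ball \<zeta> r \<Longrightarrow> phi z = C * exp (- lam * (q z)\<^sup>2)"
  obtains \<gamma> :: "real \<Rightarrow> complex" where
    "\<And>t. t \<ge> 0 \<Longrightarrow> ((\<lambda>z. flow z t) \<longlongrightarrow> \<gamma> t) (at (exp (\<i> * of_real (a * t)) * \<zeta>) within ball 0 1)"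
    "\<gamma> 0 = \<zeta>" "continuous_on {0..} \<gamma>"
    "\<And>t. t > 0 \<Longrightarrow> C * exp (- lam * of_real t) \<in> phi ` ball 0 1"
    "\<And>t. t > 0 \<Longrightarrow> \<gamma> t = psi (C * exp (- lam * of_real t))"
    "((\<lambda>t. Arg (1 - cnj \<zeta> * \<gamma> t)) \<longlongrightarrow> 0) (at_right 0)"
proof -
  have "\<zeta> \<in> ball \<zeta> r" using r by simp
  have "deriv q \<zeta> \<noteq> 0" using \<kappa> by auto
  then obtain r1 where r1: "r1 > 0" "ball \<zeta> r1 \<subseteq> ball \<zeta> r" "open (q ` ball \<zeta> r1)" "inj_on q (ball \<zeta> r1)"
    using has_complex_derivative_locally_invertible[OF q_holo \<open>\<zeta> \<in> ball \<zeta> r\<close>] by auto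
  define U where "U = q ` ball \<zeta> r1"
  have q_holo1: "q holomorphic_on ball \<zeta> r1" using q_holo r1 by (meson holomorphic_on_subset)
  \<comment> \<open>Multiplying \<open>phi\<close> by \<open>exp (- lam * t)\<close> adds
    \<open>t\<close> to \<open>q^2\<close>. The trajectory issuing from the zero
    \<open>\<zeta>\<close> of \<open>q\<close> is therefore \<open>k (sqrt t)\<close>, with
    \<open>k\<close> the local inverse of \<open>q\<close>.\<close>
  obtain k where k: "k holomorphic_on U"
      "\<And>z. z \<in> ball \<zeta> r1 \<Longrightarrow> deriv q z * deriv k (q z) = 1"
      "\<And>z. z \<in> ball \<zeta> r1 \<Longrightarrow> k (q z) = z"
    unfolding U_def using holomorphic_has_inverse[OF q_holo1 _ r1(4)] by (metis open_ball)
  have U0: "0 \<in> U" "open U" using r1 q0 by (auto simp: U_def intro!: image_eqI[of _ _ \<zeta>])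
  have k0: "k 0 = \<zeta>" using k(3)[of \<zeta>] r1 q0 by simp
  have qk: "q (k s) = s" "k s \<in> ball \<zeta> r" if "s \<in> U" for s
    using that k(3) r1(2) by (auto simp: U_def)
  have cnj: "cnj \<zeta> * \<zeta> = 1" using \<zeta> by (metis complex_norm_square mult.commute of_real_1 power_one)
  have dk: "deriv k 0 = - \<zeta> / of_real \<kappa>"
  proof -
    have "deriv q \<zeta> * deriv k 0 = 1" using k(2)[of \<zeta>] r1 q0 by simp
    then have "(deriv q \<zeta> * \<zeta>) * deriv k 0 = \<zeta>" by (metis mult.assoc mult.commute mult_1)
    then have "- (of_real \<kappa> * deriv k 0) = \<zeta>" unfolding \<kappa>(2) by simp
    then show ?thesis using \<kappa>(1) by (auto simp: field_simps)
  qed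
  have k_der: "(k has_field_derivative deriv k 0) (at 0)"
    using holomorphic_derivI[OF k(1) U0(2,1)] .
  \<comment> \<open>This quotient tends to the positive number \<open>1 / \<kappa>\<close>, which
    gives two facts at once: \<open>k s\<close> enters the disc for small \<open>s > 0\<close>,
    because \<open>|k s|^2 = 1 - s (2 Re m - s |m|^2)\<close>, and it does so in the radial
    direction.\<close>
  define m where "m s = (1 - cnj \<zeta> * k (of_real s)) / of_real s" for s :: real
  have m_lim: "(m \<longlongrightarrow> 1 / of_real \<kappa>) (at_right 0)"
  proof -
    have "((\<lambda>h. (k h - k 0) / h) \<longlongrightarrow> deriv k 0) (at 0)"
      using k_der by (simp add: has_field_derivative_iff)
    then have "((\<lambda>h. - cnj \<zeta> * ((k h - k 0) / h)) \<longlongrightarrow> - cnj \<zeta> * deriv k 0) (at 0)"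
      by (intro tendsto_intros)
    moreover have "filterlim (\<lambda>s::real. complex_of_real s) (at 0) (at_right 0)"
      by (auto simp: filterlim_at eventually_at_filter intro!: tendsto_eq_intros)
    ultimately have "((\<lambda>s::real. - cnj \<zeta> * ((k (of_real s) - k 0) / of_real s)) \<longlongrightarrow> - cnj \<zeta> * deriv k 0) (at_right 0)"
      by (rule filterlim_compose)
    moreover have "- cnj \<zeta> * ((k (of_real s) - k 0) / of_real s) = m s" for s
      using cnj by (simp add: m_def k0 right_diff_distrib diff_divide_distrib)
    moreover have "- cnj \<zeta> * deriv k 0 = 1 / of_real \<kappa>"
      using cnj by (simp add: dk)
    ultimately show ?thesis by simp
  qed
  have "\<forall>\<^sub>F s in at_right 0. of_real s \<in> U"
  proof -
    have "((\<lambda>s::real. complex_of_real s) \<longlongrightarrow> of_real 0) (at_right 0)"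
      by (intro tendsto_intros)
    then show ?thesis using U0 by (auto dest: topological_tendstoD)
  qed
  moreover have "\<forall>\<^sub>F s in at_right 0. k (of_real s) \<in> ball 0 1"
  proof -
    have "((\<lambda>s. 2 * Re (m s) - s * (norm (m s))\<^sup>2) \<longlongrightarrow> 2 * Re (1 / of_real \<kappa>) - 0 * (norm (1 / complex_of_real \<kappa>))\<^sup>2) (at_right 0)"
      by (intro tendsto_intros m_lim)
    then have "\<forall>\<^sub>F s in at_right 0. 0 < 2 * Re (m s) - s * (norm (m s))\<^sup>2"
      using \<kappa> by (intro order_tendstoD(1)[where y = "2 * Re (1 / of_real \<kappa>) - 0 * (norm (1 / complex_of_real \<kappa>))\<^sup>2"])
         (auto simp: Re_divide_of_real)
    moreover have "\<forall>\<^sub>F s in at_right 0. (0::real) < s"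
      by (simp add: eventually_at_right_less)
    ultimately show ?thesis
    proof eventually_elim
      case (elim s)
      have eq: "cnj \<zeta> * k (of_real s) = 1 - of_real s * m s"
        using elim by (simp add: m_def)
      have "(norm (cnj \<zeta> * k (of_real s)))\<^sup>2 = 1 - s * (2 * Re (m s) - s * (norm (m s))\<^sup>2)"
        unfolding eq cmod_power2 by (simp add: power2_eq_square algebra_simps)
      also have "\<dots> < 1" using elim by simp
      finally show ?case using \<zeta> by (simp add: norm_mult abs_square_less_1)
    qed
  qed
  ultimately have "\<forall>\<^sub>F s in at_right 0. of_real s \<in> U \<and> k (of_real s) \<in> ball 0 1"
    by (rule eventually_conj)
  then obtain s0 where s0: "s0 > 0" "\<And>s. 0 < s \<Longrightarrow> s < s0 \<Longrightarrow> of_real s \<in> U \<and> k (of_real s) \<in> ball 0 1"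
    unfolding eventually_at_right_field by auto
  have phi_k: "phi (k (of_real s)) = C * exp (- lam * of_real (s\<^sup>2))" if "0 < s" "s < s0" for s
    using phi_q[of "k (of_real s)"] s0(2)[OF that] qk[of "of_real s"] by simp
  have C_in: "C * exp (- lam * of_real t) \<in> phi ` ball 0 1" if "t > 0" for t
  proof -
    \<comment> \<open>The chart reaches the point only for small times, so start at time
      \<open>s^2 \<le> t\<close> inside the chart and let invariance cover the remaining time
      \<open>t - s^2\<close>.\<close>
    define s where "s = min (s0 / 2) (sqrt t)"
    have s: "0 < s" "s < s0" "s \<le> sqrt t" using that s0 by (auto simp: s_def)
    then have "s\<^sup>2 \<le> t" using that by (metis less_eq_real_def power_mono real_sqrt_pow2)
    have "C * exp (- lam * of_real t) = phi (k (of_real s)) * exp (- lam * of_real (t - s\<^sup>2))"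
      unfolding phi_k[OF s(1,2)] by (simp add: algebra_simps flip: exp_add)
    also have "\<dots> \<in> phi ` ball 0 1"
      using s0(2)[OF s(1,2)] \<open>s\<^sup>2 \<le> t\<close> by (intro spiral_invariant imageI) auto
    finally show ?thesis .
  qed
  \<comment> \<open>The initial value is set by hand, since \<open>C\<close> is only known as a
    boundary limit and \<open>psi C\<close> would say nothing.\<close>
  define \<gamma> where "\<gamma> t = (if t \<le> 0 then \<zeta> else psi (C * exp (- lam * of_real t)))" for t
  have \<gamma>_k: "\<gamma> t = k (of_real (sqrt t))" if "0 \<le> t" "t < s0\<^sup>2" for t
  proof (cases "t = 0")
    case False
    then have t: "0 < sqrt t" "sqrt t < s0"
      using that s0(1) by (auto simp: real_sqrt_less_iff intro: real_less_lsqrt)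
    have "psi (phi (k (of_real (sqrt t)))) = k (of_real (sqrt t))"
      using s0(2)[OF t] by simp
    then show ?thesis using phi_k[OF t] that False by (simp add: \<gamma>_def)
  qed (simp add: \<gamma>_def k0)
  show ?thesis
  proof
    fix t :: real assume "t \<ge> 0"
    let ?F = "at (exp (\<i> * of_real (a * t)) * \<zeta>) within ball 0 1"
    show "((\<lambda>z. flow z t) \<longlongrightarrow> \<gamma> t) ?F"
    proof (cases "t = 0")
      case True
      have "((\<lambda>z. z) \<longlongrightarrow> \<zeta>) (at \<zeta> within ball 0 1)" by (rule tendsto_ident_at)
      then have "((\<lambda>z. flow z 0) \<longlongrightarrow> \<zeta>) (at \<zeta> within ball 0 1)"
        by (rule Lim_transform_eventually) (auto simp: eventually_at_filter)
      then show ?thesis using True by (simp add: \<gamma>_def)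
    next
      \<comment> \<open>The chart gives \<open>phi\<close> the limit \<open>C\<close> at
        \<open>\<zeta>\<close>. The factor \<open>exp (- lam * t)\<close> moves this limit into the
        open image, where \<open>psi\<close> is continuous.\<close>
      case False
      with \<open>t \<ge> 0\<close> have t: "t > 0" by simp
      have "((\<lambda>z. exp (- \<i> * of_real (a * t)) * z) \<longlongrightarrow> exp (- \<i> * of_real (a * t)) * (exp (\<i> * of_real (a * t)) * \<zeta>)) ?F"
        by (intro tendsto_intros)
      also have "exp (- \<i> * of_real (a * t)) * (exp (\<i> * of_real (a * t)) * \<zeta>) = \<zeta>"
        by (simp add: exp_minus)
      finally have rot: "((\<lambda>z. exp (- \<i> * of_real (a * t)) * z) \<longlongrightarrow> \<zeta>) ?F" .
      have "isCont q \<zeta>"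
        using q_holo r by (auto intro!: continuous_on_interior[OF holomorphic_on_imp_continuous_on])
      then have "((\<lambda>z. C * exp (- lam * (q (exp (- \<i> * of_real (a * t)) * z))\<^sup>2)) \<longlongrightarrow> C * exp (- lam * (q \<zeta>)\<^sup>2)) ?F"
        by (intro tendsto_intros isCont_tendsto_compose[OF _ rot])
      moreover have "\<forall>\<^sub>F z in ?F. C * exp (- lam * (q (exp (- \<i> * of_real (a * t)) * z))\<^sup>2)
           = phi (exp (- \<i> * of_real (a * t)) * z)"
      proof -
        have "\<forall>\<^sub>F z in ?F. exp (- \<i> * of_real (a * t)) * z \<in> ball \<zeta> r"
          using rot r by (intro topological_tendstoD) auto
        moreover have "\<forall>\<^sub>F z in ?F. z \<in> ball 0 1"
          by (simp add: eventually_at_filter)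
        ultimately show ?thesis
          by eventually_elim (simp only: phi_q Int_iff rot_in_ball)
      qed
      ultimately have "((\<lambda>z. phi (exp (- \<i> * of_real (a * t)) * z)) \<longlongrightarrow> C * exp (- lam * (q \<zeta>)\<^sup>2)) ?F"
        by (rule Lim_transform_eventually)
      then have "((\<lambda>z. exp (- lam * of_real t) * phi (exp (- \<i> * of_real (a * t)) * z)) \<longlongrightarrow>
          exp (- lam * of_real t) * C) ?F"
        by (intro tendsto_intros) (simp add: q0)
      moreover have "isCont psi (exp (- lam * of_real t) * C)"
        using DERIV_isCont[OF psi_deriv[OF C_in[OF t]]] by (simp add: mult.commute)
      ultimately have "((\<lambda>z. flow z t) \<longlongrightarrow> psi (exp (- lam * of_real t) * C)) ?F"
        unfolding flow_def by (intro isCont_tendsto_compose[where g = psi])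
      then show ?thesis using t by (simp add: \<gamma>_def mult.commute)
    qed
  next
    show "\<gamma> 0 = \<zeta>" by (simp add: \<gamma>_def)
  next
    have "isCont k (of_real (sqrt 0))"
      using DERIV_isCont[OF k_der] by simp
    then have "((\<lambda>t. k (of_real (sqrt t))) \<longlongrightarrow> k (of_real (sqrt 0))) (at 0 within {0..})"
      by (rule isCont_tendsto_compose) (intro tendsto_intros)
    moreover have "\<forall>\<^sub>F t in at 0 within {0..}. k (of_real (sqrt t)) = \<gamma> t"
      unfolding eventually_at using s0(1)
      by (intro exI[of _ "s0\<^sup>2"]) (auto simp: \<gamma>_k)
    ultimately have "(\<gamma> \<longlongrightarrow> k (of_real (sqrt 0))) (at 0 within {0..})"
      by (rule Lim_transform_eventually)
    then have lim_0: "(\<gamma> \<longlongrightarrow> \<gamma> 0) (at 0 within {0..})"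
      using \<gamma>_k[of 0] s0(1) by simp
    have isCont_pos: "isCont \<gamma> t" if "t > 0" for t
    proof -
      have "isCont (\<lambda>s. psi (C * exp (- lam * of_real s))) t"
        by (rule has_vector_derivative_continuous[OF trajectory_vector_deriv[OF C_in[OF that]]])
      moreover have "\<forall>\<^sub>F s in nhds t. \<gamma> s = psi (C * exp (- lam * of_real s))"
        using eventually_nhds_in_open[of "{0<..}" t] that
        by (auto simp: \<gamma>_def elim: eventually_mono)
      ultimately show ?thesis by (simp add: isCont_cong)
    qed
    show "continuous_on {0..} \<gamma>"
      unfolding continuous_on_eq_continuous_within
    proof
      fix t :: real assume "t \<in> {0..}"
      then show "continuous (at t within {0..}) \<gamma>"
        using lim_0 continuous_at_imp_continuous_at_within[OF isCont_pos[of t]]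
        by (cases "t = 0") (auto simp: continuous_within)
    qed
  next
    show "C * exp (- lam * of_real t) \<in> phi ` ball 0 1" if "t > 0" for t
      by (rule C_in[OF that])
    show "\<gamma> t = psi (C * exp (- lam * of_real t))" if "t > 0" for t
      using that by (simp add: \<gamma>_def)
  next
    have "filterlim sqrt (at_right 0) (at_right 0)"
      by (auto simp: filterlim_at eventually_at_filter intro!: tendsto_eq_intros)
    from filterlim_compose[OF m_lim this]
    have "((\<lambda>t. m (sqrt t)) \<longlongrightarrow> 1 / of_real \<kappa>) (at_right 0)" .
    moreover have "isCont Arg (1 / of_real \<kappa>)"
      using \<kappa> by (intro continuous_at_Arg) (auto simp: complex_nonpos_Reals_iff Re_divide_of_real)
    ultimately have "((\<lambda>t. Arg (m (sqrt t))) \<longlongrightarrow> Arg (1 / of_real \<kappa>)) (at_right 0)" (is ?lim)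
      by (intro isCont_tendsto_compose[where g = Arg])
    have Arg_0: "Arg (1 / of_real \<kappa>) = 0"
      using \<kappa> Arg_of_real[of "1 / \<kappa>"] by simp
    note \<open>?lim\<close>[unfolded Arg_0]
    \<comment> \<open>Division by the positive number \<open>sqrt t\<close> leaves the argument
      unchanged, so the quotient \<open>m\<close> decides it.\<close>
    moreover have "\<forall>\<^sub>F t in at_right 0. Arg (m (sqrt t)) = Arg (1 - cnj \<zeta> * \<gamma> t)"
    proof -
      have "Arg (m (sqrt t)) = Arg (1 - cnj \<zeta> * \<gamma> t)" if "0 < t" "t < s0\<^sup>2" for t
      proof -
        have "m (sqrt t) = (1 - cnj \<zeta> * \<gamma> t) / of_real (sqrt t)"
          using that by (simp add: m_def \<gamma>_k)
        then show ?thesis using that by (simp only: Arg_divide_of_real real_sqrt_gt_zero)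
      qed
      then show ?thesis
        unfolding eventually_at_right_field using s0(1) by (intro exI[of _ "s0\<^sup>2"]) auto
    qed
    ultimately show "((\<lambda>t. Arg (1 - cnj \<zeta> * \<gamma> t)) \<longlongrightarrow> 0) (at_right 0)"
      by (rule Lim_transform_eventually)
  qed
qed

text \<open>The simple zero of \<open>phi' / phi\<close> at \<open>\<zeta>\<close> makes
  \<open>- log (phi / C) / lam\<close> vanish to second order, so it is the square of a conformal
  \<open>q\<close>. The value of \<open>M\<close> at \<open>\<zeta>\<close> fixes the derivative of
  \<open>q\<close> up to sign: its square is \<open>1 / (4 \<beta> \<zeta>^2)\<close>.\<close>

lemma local_square_root:
  assumes \<zeta>: "norm \<zeta> = 1" "\<zeta> \<in> V" and V: "open V" "0 \<notin> V" and \<beta>: "0 < \<beta>"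
    and M: "M holomorphic_on V" "M \<zeta> = lam / (2 * of_real \<beta> * \<zeta>\<^sup>2)"
    and phi_M: "\<And>z. z \<in> V \<inter> ball 0 1 \<Longrightarrow> deriv phi z = (\<zeta> - z) * M z * phi z"
  obtains q r C where "0 < r" "q holomorphic_on ball \<zeta> r" "q \<zeta> = 0"
    "deriv q \<zeta> * \<zeta> = - of_real (1 / (2 * sqrt \<beta>))" "C \<noteq> 0"
    "\<And>z. z \<in> ball 0 1 \<inter> ball \<zeta> r \<Longrightarrow> phi z = C * exp (- lam * (q z)\<^sup>2)"
proof -
  obtain r0 where r0: "r0 > 0" "ball \<zeta> r0 \<subseteq> V"
    using V \<zeta> open_contains_ball by blast
  have M_holo: "M holomorphic_on ball \<zeta> r0" using M r0 by (meson holomorphic_on_subset)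
  obtain g where g: "\<And>z. z \<in> ball \<zeta> r0 \<Longrightarrow> (g has_field_derivative (\<zeta> - z) * M z) (at z within ball \<zeta> r0)"
  proof (rule holomorphic_convex_primitive'[of "ball \<zeta> r0" "\<lambda>z. (\<zeta> - z) * M z"])
    show "(\<lambda>z. (\<zeta> - z) * M z) holomorphic_on ball \<zeta> r0"
      by (intro holomorphic_intros M_holo)
  qed auto
  have g': "(g has_field_derivative (\<zeta> - z) * M z) (at z)" if "z \<in> ball \<zeta> r0" for z
    using g[OF that] at_within_open[OF that] by simp
  \<comment> \<open>\<open>g\<close> is a primitive of \<open>(\<zeta> - z) * M z\<close> on a full
    disc about \<open>\<zeta>\<close>, beyond the unit circle, so that the double zero of
    \<open>u\<close> can be factored at an interior point.\<close>
  define u where "u z = - (g z - g \<zeta>) / lam" for z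
  have u_der: "(u has_field_derivative (z - \<zeta>) * M z / lam) (at z)" if "z \<in> ball \<zeta> r0" for z
  proof -
    have "((\<lambda>z. - (g z - g \<zeta>) / lam) has_field_derivative - ((\<zeta> - z) * M z - 0) / lam) (at z)"
      by (intro DERIV_cdivide DERIV_minus DERIV_diff DERIV_const g'[OF that])
    then show ?thesis by (simp add: u_def[abs_def] left_diff_distrib)
  qed
  then have u_holo: "u holomorphic_on ball \<zeta> r0" by (meson holomorphic_on_open open_ball)
  have u1: "deriv u z = (z - \<zeta>) * M z / lam" if "z \<in> ball \<zeta> r0" for z
    using DERIV_imp_deriv[OF u_der[OF that]] .
  have \<zeta>_in: "\<zeta> \<in> ball \<zeta> r0" using r0 by simp
  have "\<zeta> \<noteq> 0" using \<zeta> by auto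
  have u2: "(deriv u has_field_derivative M \<zeta> / lam) (at \<zeta>)"
  proof -
    have "(M has_field_derivative deriv M \<zeta>) (at \<zeta>)"
      using holomorphic_derivI[OF M_holo _ \<zeta>_in] by auto
    then have "((\<lambda>z. (z - \<zeta>) * M z / lam) has_field_derivative M \<zeta> / lam) (at \<zeta>)"
      by (auto intro!: derivative_eq_intros)
    then show ?thesis
      by (rule has_field_derivative_transform_within_open[OF _ open_ball \<zeta>_in]) (simp add: u1)
  qed
  have "(deriv ^^ 2) u \<zeta> \<noteq> 0"
    using DERIV_imp_deriv[OF u2] M(2) \<beta> \<open>\<zeta> \<noteq> 0\<close> by (simp add: numeral_2_eq_2)
  moreover have "(deriv ^^ i) u \<zeta> = 0" if "0 < i" "i < 2" for i
  proof -
    have "i = 1" using that by simp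
    then show ?thesis using u1[OF \<zeta>_in] by simp
  qed
  ultimately obtain h r1 where h: "0 < r1" "h holomorphic_on ball \<zeta> r1"
      "\<And>z. z \<in> ball \<zeta> r1 \<Longrightarrow> u z - u \<zeta> = ((z - \<zeta>) * h z)\<^sup>2"
  proof (rule holomorphic_factor_order_of_zero_strong[OF u_holo open_ball \<zeta>_in zero_less_numeral])
    fix g r assume "0 < r" "g holomorphic_on ball \<zeta> r"
      "\<And>w. w \<in> ball \<zeta> r \<Longrightarrow> u w - u \<zeta> = ((w - \<zeta>) * g w)\<^sup>2"
    then show thesis by (rule that)
  qed
  define r where "r = min r0 r1"
  have r: "r > 0" "r \<le> r0" "r \<le> r1" using h r0 by (auto simp: r_def)
  have \<zeta>_in': "\<zeta> \<in> ball \<zeta> r" using r by simp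
  define q0 where "q0 z = (z - \<zeta>) * h z" for z
  have q0_holo: "q0 holomorphic_on ball \<zeta> r"
    unfolding q0_def using r by (intro holomorphic_intros holomorphic_on_subset[OF h(2)]) auto
  have u_q0: "u z = (q0 z)\<^sup>2" if "z \<in> ball \<zeta> r" for z
    using h(3)[of z] that r by (simp add: q0_def u_def)
  have q0_0: "q0 \<zeta> = 0" by (simp add: q0_def)
  have "(deriv u has_field_derivative 2 * (deriv q0 \<zeta>)\<^sup>2) (at \<zeta>)"
  proof -
    have q0_der: "(q0 has_field_derivative deriv q0 z) (at z)" if "z \<in> ball \<zeta> r" for z
      using holomorphic_derivI[OF q0_holo _ that] by auto
    have "(deriv q0 has_field_derivative deriv (deriv q0) \<zeta>) (at \<zeta>)"
      using holomorphic_derivI[OF holomorphic_deriv[OF q0_holo] _ \<zeta>_in'] by auto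
    then have sq: "((\<lambda>z. 2 * q0 z * deriv q0 z) has_field_derivative 2 * (deriv q0 \<zeta>)\<^sup>2) (at \<zeta>)"
      by (rule DERIV_cong[OF DERIV_mult[OF DERIV_cmult[OF q0_der[OF \<zeta>_in']]]])
         (simp add: q0_0 power2_eq_square)
    have u': "deriv u z = 2 * q0 z * deriv q0 z" if "z \<in> ball \<zeta> r" for z
    proof -
      have "((\<lambda>z. (q0 z)\<^sup>2) has_field_derivative 2 * q0 z * deriv q0 z) (at z)"
        using q0_der[OF that] by (auto intro!: derivative_eq_intros)
      then have "(u has_field_derivative 2 * q0 z * deriv q0 z) (at z)"
        by (rule has_field_derivative_transform_within_open[OF _ open_ball that]) (simp add: u_q0)
      then show ?thesis by (rule DERIV_imp_deriv)
    qed
    show ?thesis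
      by (rule has_field_derivative_transform_within_open[OF sq open_ball \<zeta>_in']) (simp add: u')
  qed
  then have "M \<zeta> / lam = 2 * (deriv q0 \<zeta>)\<^sup>2"
    using u2 DERIV_unique by blast
  then have "(deriv q0 \<zeta>)\<^sup>2 = M \<zeta> / lam / 2"
    by simp
  then have "(deriv q0 \<zeta>)\<^sup>2 = 1 / (4 * of_real \<beta> * \<zeta>\<^sup>2)"
    by (simp add: M(2))
  moreover have "(complex_of_real (sqrt \<beta>))\<^sup>2 = of_real \<beta>"
    using \<beta> by (simp flip: of_real_power)
  ultimately have "(2 * of_real (sqrt \<beta>) * (deriv q0 \<zeta> * \<zeta>))\<^sup>2 = 1"
    using \<beta> \<open>\<zeta> \<noteq> 0\<close> by (simp add: power_mult_distrib)
  then have "2 * of_real (sqrt \<beta>) * (deriv q0 \<zeta> * \<zeta>) = 1 \<or> 2 * of_real (sqrt \<beta>) * (deriv q0 \<zeta> * \<zeta>) = - 1"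
    by (simp add: power2_eq_1_iff)
  \<comment> \<open>The sign \<open>e\<close> is chosen so that \<open>q\<close> decreases in the
    outward radial direction, hence positive values of \<open>q\<close> lead into the unit
    disc.\<close>
  then obtain e :: complex where e: "e = 1 \<or> e = -1" "e * (2 * of_real (sqrt \<beta>) * (deriv q0 \<zeta> * \<zeta>)) = - 1"
  proof
    assume "2 * of_real (sqrt \<beta>) * (deriv q0 \<zeta> * \<zeta>) = 1"
    then show ?thesis using that[of "-1"] by simp
  next
    assume "2 * of_real (sqrt \<beta>) * (deriv q0 \<zeta> * \<zeta>) = - 1"
    then show ?thesis using that[of 1] by simp
  qed
  define q where "q z = e * q0 z" for z
  have q_sq: "(q z)\<^sup>2 = (q0 z)\<^sup>2" for z using e by (auto simp: q_def)
  have dq: "deriv q \<zeta> = e * deriv q0 \<zeta>"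
    unfolding q_def using q0_holo r by (intro deriv_cmult) (auto intro!: holomorphic_on_imp_differentiable_at)
  \<comment> \<open>\<open>phi\<close> is known to satisfy the differential equation only inside the
    unit disc. The intersection \<open>B\<close> is convex, so one constant relates
    \<open>phi\<close> to \<open>exp g\<close> on all of it.\<close>
  define B where "B = ball 0 1 \<inter> ball \<zeta> r"
  have "((\<lambda>z. phi z * exp (- g z)) has_field_derivative 0) (at z within B)" if "z \<in> B" for z
  proof -
    have z: "z \<in> ball 0 1" "z \<in> ball \<zeta> r0" using that r by (auto simp: B_def)
    then have "z \<in> V" using r0 by blast
    note z = z this
    have "(phi has_field_derivative (\<zeta> - z) * M z * phi z) (at z)"
      using holomorphic_derivI[OF phi_holo open_ball z(1)] phi_M[of z] z by (simp only: Int_iff)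
    from DERIV_mult[OF this DERIV_chain2[OF DERIV_exp DERIV_minus[OF g'[OF z(2)]]]]
    have "((\<lambda>z. phi z * exp (- g z)) has_field_derivative 0) (at z)"
      by (simp add: mult_ac)
    then show ?thesis by (rule has_field_derivative_at_within)
  qed
  moreover have "convex B" by (simp add: B_def convex_Int)
  ultimately have "\<exists>c. \<forall>z\<in>B. phi z * exp (- g z) = c"
    by (intro has_field_derivative_zero_constant)
  then obtain c where c: "\<And>z. z \<in> B \<Longrightarrow> phi z * exp (- g z) = c"
    by blast
  define C where "C = c * exp (g \<zeta>)"
  have phi_q: "phi z = C * exp (- lam * (q z)\<^sup>2)" if "z \<in> B" for z
  proof -
    have "g z = g \<zeta> - lam * (q z)\<^sup>2"
    proof -
      have "- (g z - g \<zeta>) / lam = (q z)\<^sup>2"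
        using that u_q0[of z] unfolding q_sq u_def B_def by blast
      then have "- (g z - g \<zeta>) = (q z)\<^sup>2 * lam"
        by (simp only: divide_eq_eq lam_simps not_False_eq_True if_True)
      then show ?thesis by (simp add: algebra_simps)
    qed
    then have "C * exp (- lam * (q z)\<^sup>2) = c * exp (g z)"
      by (simp add: C_def mult.assoc flip: exp_add)
    also have "\<dots> = phi z" using c[OF that] by (simp add: exp_minus field_simps)
    finally show ?thesis by simp
  qed
  have "C \<noteq> 0"
  proof
    assume "C = 0"
    \<comment> \<open>With \<open>C = 0\<close>, \<open>phi\<close> would vanish at a point of
      \<open>B\<close>. Its only zero is the origin, which \<open>V\<close> excludes.\<close>
    have "\<zeta> \<in> closure (ball 0 1)" using \<zeta> by simp
    then obtain z where "z \<in> ball 0 1" "dist z \<zeta> < r"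
      using r(1) unfolding closure_approachable by blast
    then have z: "z \<in> B" by (simp add: B_def dist_commute)
    then have "z = 0" using phi_q[OF z] \<open>C = 0\<close> by simp
    moreover have "z \<in> ball \<zeta> r0" using z r by (simp add: B_def)
    ultimately show False using r0 V by blast
  qed
  show ?thesis
  proof (rule that[of r q C])
    show "q holomorphic_on ball \<zeta> r" unfolding q_def by (intro holomorphic_intros q0_holo)
    show "deriv q \<zeta> * \<zeta> = - of_real (1 / (2 * sqrt \<beta>))"
    proof -
      have "2 * of_real (sqrt \<beta>) * (deriv q \<zeta> * \<zeta>) = - 1" using e(2) by (simp add: dq mult_ac)
      then show ?thesis using \<beta> by (simp add: field_simps) 
    qed
  qed (use r q0_0 \<open>C \<noteq> 0\<close> phi_q in \<open>auto simp: q_def B_def\<close>)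
qed

end

section \<open>Rotating Herglotz data\<close>

lemma Re_herglotz_kernel:
  fixes \<zeta> z :: complex
  assumes "norm \<zeta> = 1"
  shows "Re ((\<zeta> + z) / (\<zeta> - z)) = (1 - (norm z)\<^sup>2) / (norm (\<zeta> - z))\<^sup>2"
proof -
  have "(Re \<zeta>)\<^sup>2 + (Im \<zeta>)\<^sup>2 = 1"
    using assms by (metis cmod_power2 power_one)
  then have "(Re \<zeta> + Re z) * (Re \<zeta> - Re z) + (Im \<zeta> + Im z) * (Im \<zeta> - Im z) = 1 - (norm z)\<^sup>2"
    unfolding cmod_power2 by (simp add: power2_eq_square algebra_simps)
  then show ?thesis
    unfolding cmod_power2 by (simp add: Re_divide flip: cmod_power2)
qed

text \<open>\<open>xi_hat\<close> is \<open>b + \<i> a\<close> divided by its conjugate, so its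
  argument is twice that of \<open>b + \<i> a\<close>; since \<open>arctan\<close> stays in
  \<open>(- pi / 2, pi / 2)\<close>, the doubled angle remains principal. Hence half of
  \<open>Arg\<close> recovers the angle.\<close>

lemma polar_arctan:
  fixes a b :: real
  assumes "b > 0"
  defines "\<theta> \<equiv> arctan (a / b)" and "m \<equiv> b * sqrt (1 + (a / b)\<^sup>2)"
  shows "of_real b + \<i> * of_real a = of_real m * exp (\<i> * of_real \<theta>)"
    and "of_real b - \<i> * of_real a = of_real m * exp (- (\<i> * of_real \<theta>))"
    and "Arg (xi_hat (a / b)) = 2 * \<theta>"
    and "m > 0"
proof -
  have pos: "0 < sqrt (1 + (a / b)\<^sup>2)" by (simp add: add_pos_nonneg)
  have m_cos: "m * cos \<theta> = b" and m_sin: "m * sin \<theta> = a"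
    using pos assms(1) by (simp_all add: \<theta>_def m_def cos_arctan sin_arctan)
  show 1: "of_real b + \<i> * of_real a = of_real m * exp (\<i> * of_real \<theta>)"
    using m_cos m_sin by (simp add: complex_eq_iff Re_exp Im_exp)
  show 2: "of_real b - \<i> * of_real a = of_real m * exp (- (\<i> * of_real \<theta>))"
    using m_cos m_sin by (simp add: complex_eq_iff Re_exp Im_exp)
  show "m > 0" using pos assms(1) by (simp add: m_def)
  have "xi_hat (a / b) = (of_real b + \<i> * of_real a) / (of_real b - \<i> * of_real a)"
  proof -
    have "1 + \<i> * of_real (a / b) = (of_real b + \<i> * of_real a) / of_real b"
      "1 - \<i> * of_real (a / b) = (of_real b - \<i> * of_real a) / of_real b"
      using assms(1) by (simp_all add: add_divide_distrib diff_divide_distrib)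
    then show ?thesis unfolding xi_hat_def using assms(1) by simp
  qed
  also have "\<dots> = exp (\<i> * of_real \<theta>) / exp (- (\<i> * of_real \<theta>))"
    unfolding 1 2 using \<open>m > 0\<close> by simp
  also have "\<dots> = exp (\<i> * of_real (2 * \<theta>))"
    by (simp add: exp_diff[symmetric] mult_ac)
  finally have "Arg (xi_hat (a / b)) = Arg (exp (\<i> * of_real (2 * \<theta>)))" by simp
  also have "\<dots> = 2 * \<theta>"
    using arctan_lbound[of "a / b"] arctan_ubound[of "a / b"]
    by (subst Arg_exp) (auto simp: \<theta>_def)
  finally show "Arg (xi_hat (a / b)) = 2 * \<theta>" .
qed

lemma prod_lessThan_remove:
  fixes f :: "nat \<Rightarrow> 'a::comm_monoid_mult"
  assumes "k < n"
  shows "(\<Prod>j<n. f j) = f k * (\<Prod>j\<in>{..<n} - {k}. f j)"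
  using assms by (simp add: prod.remove)

text \<open>Lagrange interpolation at the nodes \<open>0\<close> and \<open>\<xi> k\<close>, in a denominator-free form.\<close>
lemma interpolation_identity:
  fixes \<zeta> \<xi> c :: "nat \<Rightarrow> complex"
  assumes inj: "inj_on \<xi> {..<n}" and nz: "\<And>k. k < n \<Longrightarrow> \<xi> k \<noteq> 0"
    and at_0: "A * (\<Prod>k<n. \<zeta> k) = K * (\<Prod>k<n. - \<xi> k)"
    and at_xi: "\<And>k. k < n \<Longrightarrow>
      A * (\<Prod>j<n. \<zeta> j - \<xi> k) = K * (\<xi> k * c k * (\<Prod>j\<in>{..<n} - {k}. \<xi> k - \<xi> j))"
  shows "A * (\<Prod>k<n. \<zeta> k - z) =
    K * ((\<Prod>k<n. z - \<xi> k) + z * (\<Sum>k<n. c k * (\<Prod>j\<in>{..<n} - {k}. z - \<xi> j)))"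
proof -
  define P where "P = smult A (\<Prod>k<n. [:\<zeta> k, -1:])"
  define Q where "Q = smult K ((\<Prod>k<n. [:- \<xi> k, 1:]) +
     [:0, 1:] * (\<Sum>k<n. smult (c k) (\<Prod>j\<in>{..<n} - {k}. [:- \<xi> j, 1:])))"
  have P: "poly P z = A * (\<Prod>k<n. \<zeta> k - z)" for z
    by (simp add: P_def poly_prod)
  have Q: "poly Q z = K * ((\<Prod>k<n. z - \<xi> k) + z * (\<Sum>k<n. c k * (\<Prod>j\<in>{..<n} - {k}. z - \<xi> j)))" for z
    by (simp add: Q_def poly_prod poly_sum algebra_simps)
  have deg_prod: "degree (\<Prod>k\<in>S. [:u k, v k:]) \<le> card S" if "finite S" for S :: "nat set" and u v :: "nat \<Rightarrow> complex"
  proof -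
    have "degree (\<Prod>k\<in>S. [:u k, v k:]) \<le> (\<Sum>k\<in>S. degree [:u k, v k:])"
      by (rule degree_prod_sum_le[OF that, unfolded o_def])
    also have "\<dots> \<le> (\<Sum>k\<in>S. 1)" by (intro sum_mono) simp
    finally show ?thesis by simp
  qed
  have deg_P: "degree P \<le> n"
    unfolding P_def using deg_prod[of "{..<n}" \<zeta> "\<lambda>_. -1"] by (intro order.trans[OF degree_smult_le]) simp
  have deg_Q: "degree Q \<le> n"
  proof -
    have "degree (smult (c k) (\<Prod>j\<in>{..<n} - {k}. [:- \<xi> j, 1:])) \<le> n - 1" if "k < n" for k
      using deg_prod[of "{..<n} - {k}" "\<lambda>j. - \<xi> j" "\<lambda>_. 1"] that
      by (intro order.trans[OF degree_smult_le]) simp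
    then have "degree (\<Sum>k<n. smult (c k) (\<Prod>j\<in>{..<n} - {k}. [:- \<xi> j, 1:])) \<le> n - 1"
      by (intro degree_sum_le) auto
    \<comment> \<open>For \<open>n = 0\<close> the bound \<open>n - 1\<close> truncates to 0 and the
      extra factor \<open>z\<close> would exceed degree \<open>n\<close>; the sum is then
      empty.\<close>
    then have "n > 0 \<Longrightarrow> degree ([:0, 1:] * (\<Sum>k<n. smult (c k) (\<Prod>j\<in>{..<n} - {k}. [:- \<xi> j, 1:]))) \<le> n"
      by (intro order.trans[OF degree_mult_le]) simp
    moreover have "degree (\<Prod>k<n. [:- \<xi> k, 1:]) \<le> n"
      using deg_prod[of "{..<n}" "\<lambda>j. - \<xi> j" "\<lambda>_. 1"] by simp
    ultimately show ?thesis
      unfolding Q_def by (cases "n = 0") (auto intro!: order.trans[OF degree_smult_le] degree_add_le)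
  qed
  have "P = Q"
  proof (rule poly_eqI_degree)
    show "poly P z = poly Q z" if z: "z \<in> insert 0 (\<xi> ` {..<n})" for z
    proof (cases "z = 0")
      case True
      then show ?thesis unfolding P Q using at_0 by simp
    next
      case False
      then obtain k where k: "k < n" "z = \<xi> k" using z by auto
      have "(\<Sum>i<n. c i * (\<Prod>j\<in>{..<n} - {i}. \<xi> k - \<xi> j)) = c k * (\<Prod>j\<in>{..<n} - {k}. \<xi> k - \<xi> j)"
        using k(1) by (subst sum.remove[of _ k]) (auto intro!: sum.neutral)
      moreover have "(\<Prod>i<n. \<xi> k - \<xi> i) = 0" using k(1) by auto
      ultimately show ?thesis unfolding P Q k(2) using at_xi[OF k(1)] by (simp add: mult_ac)
    qed
    have "card (insert 0 (\<xi> ` {..<n})) = Suc n"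
      using inj nz by (subst card_insert_disjoint) (auto simp: card_image)
    then show "degree P < card (insert 0 (\<xi> ` {..<n}))" "degree Q < card (insert 0 (\<xi> ` {..<n}))"
      using deg_P deg_Q by auto
  qed
  then show ?thesis using P Q by metis
qed

section \<open>Roots of \<open>Q - \<i> a R\<close>, residues and partial fractions\<close>

locale loewner_kufarev =
  fixes n :: nat and \<zeta> :: "nat \<Rightarrow> complex" and bs :: "nat \<Rightarrow> real" and a :: real
    and \<xi> :: "nat \<Rightarrow> complex"
  assumes n_pos: "n \<ge> 1"
    and zeta_circ: "\<And>k. k < n \<Longrightarrow> norm (\<zeta> k) = 1"
    and zeta_inj: "inj_on \<zeta> {..<n}"
    and bs_pos: "\<And>k. k < n \<Longrightarrow> bs k > 0"
    and xi_def: "\<And>z. LK_Q n \<zeta> bs z - \<i> * of_real a * LK_R n \<zeta> z =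
        (-1) ^ (n - 1) * (of_real (\<Sum>k<n. bs k) + \<i> * of_real a) * (\<Prod>k<n. z - \<xi> k)"
begin

definition "b = (\<Sum>k<n. bs k)"
definition "herglotz z = (\<Sum>k<n. of_real (bs k) * ((\<zeta> k + z) / (\<zeta> k - z)))"
text \<open>The weighted sum of Poisson kernels with the factor \<open>1 - |z|^2\<close> removed, so
  it stays positive on the circle away from the poles, where it measures
  \<open>- z p' / 2\<close>.\<close>

definition "kernel_mass z = (\<Sum>k<n. bs k / (norm (\<zeta> k - z))\<^sup>2)"
text \<open>The leading coefficient of \<open>Q - \<i> a R\<close>.\<close>

definition "K = (-1) ^ (n - 1) * (complex_of_real b + \<i> * of_real a)"
definition "lam = complex_of_real b - \<i> * of_real a"
definition "herglotz' z = (\<Sum>k<n. of_real (bs k) * (2 * \<zeta> k / (\<zeta> k - z)\<^sup>2))"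

lemma b_pos: "b > 0"
  unfolding b_def using n_pos bs_pos by (intro sum_pos) (auto simp: lessThan_empty_iff)

lemma K_nz: "K \<noteq> 0" and lam_nz: "lam \<noteq> 0"
  using b_pos by (auto simp: K_def lam_def complex_eq_iff)

lemma Re_herglotz: "Re (herglotz z) = (1 - (norm z)\<^sup>2) * kernel_mass z"
proof -
  have "Re (of_real (bs k) * ((\<zeta> k + z) / (\<zeta> k - z))) = (1 - (norm z)\<^sup>2) * (bs k / (norm (\<zeta> k - z))\<^sup>2)"
    if "k < n" for k
  proof -
    have "Re (of_real (bs k) * w) = bs k * Re w" for w by simp
    from this[of "(\<zeta> k + z) / (\<zeta> k - z)"] show ?thesis
      unfolding Re_herglotz_kernel[OF zeta_circ[OF that]] by (simp only: mult.commute times_divide_eq_right)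
  qed
  then show ?thesis
    unfolding herglotz_def kernel_mass_def Re_sum sum_distrib_left by (intro sum.cong) auto
qed

lemma kernel_mass_pos:
  assumes "\<And>k. k < n \<Longrightarrow> z \<noteq> \<zeta> k"
  shows "kernel_mass z > 0"
  unfolding kernel_mass_def using n_pos bs_pos assms
  by (intro sum_pos divide_pos_pos) (auto simp: lessThan_empty_iff)

lemma LK_Q_eq:
  assumes "\<And>k. k < n \<Longrightarrow> z \<noteq> \<zeta> k"
  shows "LK_Q n \<zeta> bs z = LK_R n \<zeta> z * herglotz z"
  unfolding LK_Q_def herglotz_def sum_distrib_left
proof (intro sum.cong refl)
  fix k assume "k \<in> {..<n}"
  then have "LK_R n \<zeta> z = (\<zeta> k - z) * (\<Prod>j\<in>{..<n} - {k}. \<zeta> j - z)" "\<zeta> k - z \<noteq> 0"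
    using assms[of k] by (auto simp: LK_R_def prod_lessThan_remove)
  then show "of_real (bs k) * (\<zeta> k + z) * (\<Prod>j\<in>{..<n} - {k}. \<zeta> j - z) =
      LK_R n \<zeta> z * (of_real (bs k) * ((\<zeta> k + z) / (\<zeta> k - z)))"
    by simp
qed

lemma LK_R_nz: "(\<And>k. k < n \<Longrightarrow> z \<noteq> \<zeta> k) \<Longrightarrow> LK_R n \<zeta> z \<noteq> 0"
  by (auto simp: LK_R_def)

lemma factorization: "K * (\<Prod>k<n. z - \<xi> k) = LK_Q n \<zeta> bs z - \<i> * of_real a * LK_R n \<zeta> z"
  using xi_def[of z] by (simp add: K_def b_def)

lemma factorization':
  assumes "\<And>k. k < n \<Longrightarrow> z \<noteq> \<zeta> k"
  shows "K * (\<Prod>k<n. z - \<xi> k) = LK_R n \<zeta> z * (herglotz z - \<i> * of_real a)"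
proof -
  have "LK_Q n \<zeta> bs z = LK_R n \<zeta> z * herglotz z" using assms by (rule LK_Q_eq)
  then show ?thesis unfolding factorization by (simp add: algebra_simps)
qed

text \<open>At a pole \<open>R\<close> vanishes and one summand of \<open>Q\<close> survives. The
  identity separates the roots from the poles and later fixes the constant
  \<open>M (\<zeta> k)\<close>.\<close>

lemma factorization_zeta:
  assumes "k < n"
  shows "K * (\<Prod>j<n. \<zeta> k - \<xi> j) = of_real (bs k) * (2 * \<zeta> k) * (\<Prod>j\<in>{..<n} - {k}. \<zeta> j - \<zeta> k)"
proof -
  have "LK_R n \<zeta> (\<zeta> k) = 0" using assms by (auto simp: LK_R_def)
  moreover have "LK_Q n \<zeta> bs (\<zeta> k) = of_real (bs k) * (2 * \<zeta> k) * (\<Prod>j\<in>{..<n} - {k}. \<zeta> j - \<zeta> k)"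
    unfolding LK_Q_def using assms
    by (subst sum.remove[of _ k]) (auto intro!: sum.neutral)
  ultimately show ?thesis unfolding factorization by simp
qed

lemma zeta_prod_nz:
  assumes "k < n"
  shows "(\<Prod>j\<in>{..<n} - {k}. \<zeta> j - \<zeta> k) \<noteq> 0"
  using assms zeta_inj by (auto simp: inj_on_def)

lemma xi_ne_zeta:
  assumes "k < n" "j < n"
  shows "\<xi> k \<noteq> \<zeta> j"
proof
  assume "\<xi> k = \<zeta> j"
  then have "(\<Prod>i<n. \<zeta> j - \<xi> i) = 0" using assms by (auto intro!: bexI[of _ k])
  then have "of_real (bs j) * (2 * \<zeta> j) * (\<Prod>i\<in>{..<n} - {j}. \<zeta> i - \<zeta> j) = 0"
    unfolding factorization_zeta[OF assms(2), symmetric] by simp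
  then show False
    using zeta_prod_nz[OF assms(2)] bs_pos[OF assms(2)] zeta_circ[OF assms(2)] by auto
qed

lemma herglotz_xi:
  assumes "k < n"
  shows "herglotz (\<xi> k) = \<i> * of_real a"
proof -
  have ne: "\<And>j. j < n \<Longrightarrow> \<xi> k \<noteq> \<zeta> j" using xi_ne_zeta[OF assms] .
  have "LK_R n \<zeta> (\<xi> k) * (herglotz (\<xi> k) - \<i> * of_real a) = K * (\<Prod>i<n. \<xi> k - \<xi> i)"
    by (rule factorization'[symmetric]) (rule ne)
  also have "(\<Prod>i<n. \<xi> k - \<xi> i) = 0" using assms by auto
  finally show ?thesis
    using LK_R_nz[of "\<xi> k"] ne by auto
qed

text \<open>At a root \<open>Re p = 0\<close>; but \<open>Re p\<close> is \<open>1 - |z|^2\<close>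
  times a positive quantity, inside and outside the disc alike.\<close>

lemma norm_xi:
  assumes "k < n"
  shows "norm (\<xi> k) = 1"
proof -
  have "(1 - (norm (\<xi> k))\<^sup>2) * kernel_mass (\<xi> k) = 0"
    using Re_herglotz[of "\<xi> k"] herglotz_xi[OF assms] by simp
  then have "(norm (\<xi> k))\<^sup>2 = 1"
    using kernel_mass_pos[of "\<xi> k"] xi_ne_zeta[OF assms] by fastforce
  then show ?thesis by (simp add: power2_eq_1_iff) (metis norm_ge_zero not_one_le_zero neg_0_le_iff_le)
qed

lemma herglotz_deriv:
  assumes "\<And>k. k < n \<Longrightarrow> z \<noteq> \<zeta> k"
  shows "(herglotz has_field_derivative herglotz' z) (at z)"
  unfolding herglotz_def[abs_def] herglotz'_def
proof (rule DERIV_sum)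
  fix k assume "k \<in> {..<n}"
  then have "\<zeta> k - z \<noteq> 0" using assms[of k] by auto
  then show "((\<lambda>z. of_real (bs k) * ((\<zeta> k + z) / (\<zeta> k - z))) has_field_derivative
      of_real (bs k) * (2 * \<zeta> k / (\<zeta> k - z)\<^sup>2)) (at z)"
    by (intro DERIV_cmult) (auto intro!: derivative_eq_intros simp: power2_eq_square field_simps)
qed

text \<open>For unimodular \<open>\<zeta>\<close> and \<open>z\<close>, conjugation is inversion, so
  \<open>\<zeta> z / (\<zeta> - z)^2 = - 1 / |\<zeta> - z|^2\<close>. This is the source of the sign
  of the exponents and of the simplicity of the roots.\<close>

lemma herglotz'_circle:
  assumes "norm z = 1" "\<And>k. k < n \<Longrightarrow> z \<noteq> \<zeta> k"
  shows "z * herglotz' z = - of_real (2 * kernel_mass z)"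
proof -
  have "z * (of_real (bs k) * (2 * \<zeta> k / (\<zeta> k - z)\<^sup>2)) = - of_real (2 * (bs k / (norm (\<zeta> k - z))\<^sup>2))"
    if k: "k < n" for k
  proof -
    have cnj: "z * cnj z = 1" "\<zeta> k * cnj (\<zeta> k) = 1"
      using assms(1) zeta_circ[OF k] by (metis complex_norm_square of_real_1 power_one)+
    have nz: "\<zeta> k - z \<noteq> 0" "cnj (\<zeta> k) - cnj z \<noteq> 0" using assms(2)[OF k] by auto
    have "\<zeta> k * z * (cnj (\<zeta> k) - cnj z) = (\<zeta> k * cnj (\<zeta> k)) * z - \<zeta> k * (z * cnj z)"
      by (simp add: algebra_simps)
    then have "\<zeta> k * z * (cnj (\<zeta> k) - cnj z) = - (\<zeta> k - z)" by (simp add: cnj)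
    then have "\<zeta> k * z = - (\<zeta> k - z) / (cnj (\<zeta> k) - cnj z)"
      using nz(2) by (metis nonzero_eq_divide_eq)
    moreover have "- d / c / d\<^sup>2 = - 1 / (d * c)" if "d \<noteq> 0" for c d :: complex
      using that by (simp add: power2_eq_square)
    ultimately have "\<zeta> k * z / (\<zeta> k - z)\<^sup>2 = - 1 / ((\<zeta> k - z) * (cnj (\<zeta> k) - cnj z))"
      using nz(1) by metis
    also have "(\<zeta> k - z) * (cnj (\<zeta> k) - cnj z) = of_real ((norm (\<zeta> k - z))\<^sup>2)"
      unfolding complex_norm_square by simp
    finally have "2 * of_real (bs k) * (\<zeta> k * z / (\<zeta> k - z)\<^sup>2) = 2 * of_real (bs k) * (- 1 / of_real ((norm (\<zeta> k - z))\<^sup>2))"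
      by simp
    then show ?thesis by (simp add: mult_ac)
  qed
  then show ?thesis
    unfolding herglotz'_def kernel_mass_def
    by (simp add: sum_distrib_left sum_negf[symmetric])
qed

text \<open>Both sides are the derivative at \<open>\<xi> k\<close> of
  \<open>K * (\<Prod>j<n. z - \<xi> j) = R (p - \<i> a)\<close>. It links the products in
  \<open>LK_alpha\<close> to the derivative of \<open>p\<close>.\<close>

lemma xi_prod:
  assumes "k < n"
  shows "K * (\<Prod>j\<in>{..<n} - {k}. \<xi> k - \<xi> j) = LK_R n \<zeta> (\<xi> k) * herglotz' (\<xi> k)"
proof -
  have ne: "\<And>j. j < n \<Longrightarrow> \<xi> k \<noteq> \<zeta> j" using xi_ne_zeta[OF assms] .
  define G where "G z = K * (\<Prod>j\<in>{..<n} - {k}. z - \<xi> j)" for z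
  have "G holomorphic_on UNIV" unfolding G_def by (intro holomorphic_intros)
  then have "(G has_field_derivative deriv G (\<xi> k)) (at (\<xi> k))"
    by (meson UNIV_I holomorphic_derivI open_UNIV)
  then have G: "((\<lambda>z. (z - \<xi> k) * G z) has_field_derivative G (\<xi> k)) (at (\<xi> k))"
    by (auto intro!: derivative_eq_intros)
  have "LK_R n \<zeta> holomorphic_on UNIV" unfolding LK_R_def[abs_def] by (intro holomorphic_intros)
  then have "(LK_R n \<zeta> has_field_derivative deriv (LK_R n \<zeta>) (\<xi> k)) (at (\<xi> k))"
    by (meson UNIV_I holomorphic_derivI open_UNIV)
  then have "((\<lambda>z. LK_R n \<zeta> z * (herglotz z - \<i> * of_real a)) has_field_derivative
      LK_R n \<zeta> (\<xi> k) * herglotz' (\<xi> k)) (at (\<xi> k))"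
    using herglotz_deriv[of "\<xi> k"] ne herglotz_xi[OF assms]
    by (auto intro!: derivative_eq_intros)
  then have "((\<lambda>z. (z - \<xi> k) * G z) has_field_derivative LK_R n \<zeta> (\<xi> k) * herglotz' (\<xi> k)) (at (\<xi> k))"
  proof (rule has_field_derivative_transform_within_open)
    show "open (- (\<zeta> ` {..<n}))" by (intro open_Compl finite_imp_closed) simp
    show "\<xi> k \<in> - (\<zeta> ` {..<n})" using ne by auto
    fix z assume "z \<in> - (\<zeta> ` {..<n})"
    then have "\<And>j. j < n \<Longrightarrow> z \<noteq> \<zeta> j" by auto
    from factorization'[OF this] show "LK_R n \<zeta> z * (herglotz z - \<i> * of_real a) = (z - \<xi> k) * G z"
      using prod_lessThan_remove[OF assms, of "\<lambda>j. z - \<xi> j"] by (simp add: G_def mult_ac)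
  qed
  with G have "G (\<xi> k) = LK_R n \<zeta> (\<xi> k) * herglotz' (\<xi> k)" by (rule DERIV_unique)
  then show ?thesis by (simp add: G_def)
qed

lemma herglotz'_xi:
  assumes "k < n"
  shows "\<xi> k * herglotz' (\<xi> k) = - of_real (2 * kernel_mass (\<xi> k))" "kernel_mass (\<xi> k) > 0"
    "herglotz' (\<xi> k) \<noteq> 0"
proof -
  show 1: "\<xi> k * herglotz' (\<xi> k) = - of_real (2 * kernel_mass (\<xi> k))"
    using herglotz'_circle[OF norm_xi[OF assms]] xi_ne_zeta[OF assms] by simp
  show "kernel_mass (\<xi> k) > 0" using kernel_mass_pos xi_ne_zeta[OF assms] by blast
  then show "herglotz' (\<xi> k) \<noteq> 0" using 1 by auto
qed

text \<open>A repeated root would kill the product in \<open>xi_prod\<close>, while \<open>R\<close>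
  and \<open>herglotz'\<close> are nonzero there.\<close>

lemma xi_inj: "inj_on \<xi> {..<n}"
proof (rule inj_onI, rule ccontr)
  fix k j assume kj: "k \<in> {..<n}" "j \<in> {..<n}" "\<xi> k = \<xi> j" "k \<noteq> j"
  then have "(\<Prod>i\<in>{..<n} - {k}. \<xi> k - \<xi> i) = 0" by auto
  moreover have "LK_R n \<zeta> (\<xi> k) * herglotz' (\<xi> k) = K * (\<Prod>i\<in>{..<n} - {k}. \<xi> k - \<xi> i)"
    using xi_prod[of k] kj by simp
  ultimately have "LK_R n \<zeta> (\<xi> k) * herglotz' (\<xi> k) = 0" by (simp only: mult_zero_right)
  then show False using herglotz'_xi(3)[of k] LK_R_nz[of "\<xi> k"] xi_ne_zeta[of k] kj by auto
qed

definition "\<theta> = arctan (a / b)"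
text \<open>By \<open>polar_arctan\<close> this is the modulus of \<open>lam\<close>.\<close>

definition "mass = b * sqrt (1 + (a / b)\<^sup>2)"

text \<open>The sign and the phase in \<open>LK_alpha\<close> cancel those of \<open>K\<close>, by
  \<open>xi_prod\<close>. What remains is half the modulus of \<open>K\<close> divided by the
  negative number \<open>\<xi> k * herglotz' (\<xi> k)\<close>.\<close>

lemma LK_alpha_eq:
  assumes "k < n"
  shows "LK_alpha n \<zeta> (a / b) \<xi> k = - of_real (mass / (4 * kernel_mass (\<xi> k)))"
proof -
  note polar = polar_arctan[OF b_pos, of a, folded \<theta>_def mass_def]
  define S where "S = ((-1::complex) ^ (n - 1))"
  have "S * S = 1" by (simp add: S_def flip: power_mult_distrib)
  define P where "P = (\<Prod>j\<in>{..<n} - {k}. \<xi> k - \<xi> j)"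
  define R where "R = LK_R n \<zeta> (\<xi> k)"
  have "R \<noteq> 0" using LK_R_nz xi_ne_zeta[OF assms] by (simp add: R_def)
  have KP: "K * P = R * herglotz' (\<xi> k)" using xi_prod[OF assms] by (simp add: P_def R_def)
  have K: "K = S * (of_real mass * exp (\<i> * of_real \<theta>))"
    unfolding K_def polar(1) S_def ..
  have nz: "P \<noteq> 0" using KP \<open>R \<noteq> 0\<close> herglotz'_xi(3)[OF assms] by auto
  have "LK_alpha n \<zeta> (a / b) \<xi> k = S / 2 * exp (- (\<i> * of_real \<theta>)) * R / (\<xi> k * P)"
    unfolding LK_alpha_def polar(3) S_def R_def P_def by simp
  also have "\<dots> = S / 2 * exp (- (\<i> * of_real \<theta>)) * R * K / (\<xi> k * (K * P))"
    using K_nz by simp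
  also have "\<dots> = S / 2 * exp (- (\<i> * of_real \<theta>)) * K / (\<xi> k * herglotz' (\<xi> k))"
    unfolding KP using \<open>R \<noteq> 0\<close> by simp
  also have "S / 2 * exp (- (\<i> * of_real \<theta>)) * K = of_real mass / 2"
  proof -
    have "S / 2 * exp (- (\<i> * of_real \<theta>)) * K = (S * S) * of_real mass / 2 * (exp (- (\<i> * of_real \<theta>)) * exp (\<i> * of_real \<theta>))"
      unfolding K by simp
    then show ?thesis unfolding \<open>S * S = 1\<close> by (simp flip: exp_add)
  qed
  finally show ?thesis unfolding herglotz'_xi(1)[OF assms] by simp
qed

text \<open>\<open>lam / (p - \<i> a)\<close> is the rational function
  \<open>lam * R / (K * (\<Prod>k<n. z - \<xi> k))\<close>. It equals 1 at the origin because
  \<open>p 0 = b\<close>, and has residue \<open>lam / p'\<close> at each root; these data determine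
  it by interpolation.\<close>

lemma partial_fractions:
  assumes "\<And>k. k < n \<Longrightarrow> z \<noteq> \<zeta> k" "\<And>k. k < n \<Longrightarrow> z \<noteq> \<xi> k"
  shows "(1 + z * (\<Sum>k<n. lam / (\<xi> k * herglotz' (\<xi> k)) / (z - \<xi> k))) * (herglotz z - \<i> * of_real a) = lam"
proof -
  define c where "c k = lam / (\<xi> k * herglotz' (\<xi> k))" for k
  have "lam * (\<Prod>k<n. \<zeta> k - z) =
    K * ((\<Prod>k<n. z - \<xi> k) + z * (\<Sum>k<n. c k * (\<Prod>j\<in>{..<n} - {k}. z - \<xi> j)))"
  proof (rule interpolation_identity[OF xi_inj])
    show xi_nz: "\<xi> k \<noteq> 0" if "k < n" for k using norm_xi[OF that] by auto
    have z0: "0 \<noteq> \<zeta> k" if "k < n" for k using zeta_circ[OF that] by auto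
    have "herglotz 0 = of_real b"
      unfolding herglotz_def b_def of_real_sum using z0 by (intro sum.cong) auto
    then show "lam * (\<Prod>k<n. \<zeta> k) = K * (\<Prod>k<n. - \<xi> k)"
      using factorization'[of 0] z0 by (simp add: LK_R_def lam_def mult.commute)
    show "lam * (\<Prod>j<n. \<zeta> j - \<xi> k) = K * (\<xi> k * c k * (\<Prod>j\<in>{..<n} - {k}. \<xi> k - \<xi> j))" if k: "k < n" for k
    proof -
      have "K * (\<xi> k * c k * (\<Prod>j\<in>{..<n} - {k}. \<xi> k - \<xi> j)) = \<xi> k * c k * (K * (\<Prod>j\<in>{..<n} - {k}. \<xi> k - \<xi> j))"
        by (simp only: mult_ac)
      also have "\<dots> = lam * LK_R n \<zeta> (\<xi> k)"
        unfolding xi_prod[OF k] c_def using xi_nz[OF k] herglotz'_xi(3)[OF k] by simp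
      finally show ?thesis by (simp add: LK_R_def)
    qed
  qed
  also have "(\<Prod>k<n. z - \<xi> k) + z * (\<Sum>k<n. c k * (\<Prod>j\<in>{..<n} - {k}. z - \<xi> j))
     = (\<Prod>k<n. z - \<xi> k) * (1 + z * (\<Sum>k<n. c k / (z - \<xi> k)))"
  proof -
    have "(\<Prod>j<n. z - \<xi> j) * (c k / (z - \<xi> k)) = c k * (\<Prod>j\<in>{..<n} - {k}. z - \<xi> j)" if "k < n" for k
      using assms(2)[OF that] by (simp add: prod_lessThan_remove[OF that])
    then have "(\<Prod>j<n. z - \<xi> j) * (\<Sum>k<n. c k / (z - \<xi> k)) = (\<Sum>k<n. c k * (\<Prod>j\<in>{..<n} - {k}. z - \<xi> j))"
      unfolding sum_distrib_left by (intro sum.cong) auto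
    then show ?thesis by (simp add: algebra_simps)
  qed
  finally have "lam * LK_R n \<zeta> z = (K * (\<Prod>k<n. z - \<xi> k)) * (1 + z * (\<Sum>k<n. c k / (z - \<xi> k)))"
    by (simp add: LK_R_def mult.assoc)
  moreover have "K * (\<Prod>k<n. z - \<xi> k) = LK_R n \<zeta> z * (herglotz z - \<i> * of_real a)"
    using assms(1) by (rule factorization')
  moreover have "LK_R n \<zeta> z \<noteq> 0" using assms(1) by (rule LK_R_nz)
  ultimately show ?thesis
    unfolding c_def by (simp add: mult.commute mult.left_commute)
qed

end

section \<open>Branches of the powers, the explicit map and its traces\<close>

locale loewner_kufarev_branch = loewner_kufarev +
  fixes L :: "nat \<Rightarrow> complex \<Rightarrow> complex"
  assumes L_holo: "\<And>k. k < n \<Longrightarrow> L k holomorphic_on ball 0 1"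
    and L_exp: "\<And>k z. k < n \<Longrightarrow> z \<in> ball 0 1 \<Longrightarrow> exp (L k z) = z - \<xi> k"
begin

text \<open>Another choice of branches adds a constant to \<open>H\<close> and so multiplies
  \<open>phi\<close> by a constant, which cancels in the flow.\<close>

definition "H z = exp (\<i> * of_real (Arccot (a / b) - pi / 2)) *
  (\<Sum>k<n. 2 * LK_alpha n \<zeta> (a / b) \<xi> k * L k z)"

lemma ball_ne_zeta: "z \<in> ball 0 1 \<Longrightarrow> k < n \<Longrightarrow> z \<noteq> \<zeta> k"
  and ball_ne_xi: "z \<in> ball 0 1 \<Longrightarrow> k < n \<Longrightarrow> z \<noteq> \<xi> k"
  using zeta_circ[of k] norm_xi[of k] by auto

text \<open>\<open>Arccot (a / b) - pi / 2\<close> is \<open>- arctan (a / b)\<close>, the argument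
  of \<open>lam\<close>; this is the spiral angle.\<close>

lemma rotation_mass: "exp (\<i> * of_real (Arccot (a / b) - pi / 2)) * of_real mass = lam"
  using polar_arctan(2)[OF b_pos, of a, folded \<theta>_def mass_def]
  by (simp add: Arccot_def \<theta>_def lam_def mult.commute)

lemma L_deriv:
  assumes "k < n" "z \<in> ball 0 1"
  shows "(L k has_field_derivative 1 / (z - \<xi> k)) (at z)"
proof -
  have d: "(L k has_field_derivative deriv (L k) z) (at z)"
    using holomorphic_derivI[OF L_holo[OF assms(1)] open_ball assms(2)] .
  have "((\<lambda>z. exp (L k z)) has_field_derivative exp (L k z) * deriv (L k) z) (at z)"
    by (rule DERIV_chain2[OF DERIV_exp d])
  moreover have "((\<lambda>z. exp (L k z)) has_field_derivative 1) (at z)"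
  proof (rule has_field_derivative_transform_within_open[OF _ open_ball assms(2)])
    show "((\<lambda>z. z - \<xi> k) has_field_derivative 1) (at z)"
      by (auto intro!: derivative_eq_intros)
  qed (simp add: L_exp assms(1))
  ultimately have "(z - \<xi> k) * deriv (L k) z = 1"
    using DERIV_unique L_exp[OF assms] by metis
  then have "deriv (L k) z = 1 / (z - \<xi> k)"
    using ball_ne_xi[OF assms(2,1)] by (simp add: field_simps)
  with d show ?thesis by simp
qed

lemma H_deriv:
  assumes "z \<in> ball 0 1"
  shows "(H has_field_derivative (\<Sum>k<n. lam / (\<xi> k * herglotz' (\<xi> k)) / (z - \<xi> k))) (at z)"
proof -
  let ?e = "exp (\<i> * of_real (Arccot (a / b) - pi / 2))"
  have "((\<lambda>z. ?e * (\<Sum>k<n. 2 * LK_alpha n \<zeta> (a / b) \<xi> k * L k z)) has_field_derivative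
     ?e * (\<Sum>k<n. 2 * LK_alpha n \<zeta> (a / b) \<xi> k * (1 / (z - \<xi> k)))) (at z)"
    by (intro DERIV_cmult DERIV_sum L_deriv assms) auto
  moreover have "?e * (\<Sum>k<n. 2 * LK_alpha n \<zeta> (a / b) \<xi> k * (1 / (z - \<xi> k)))
     = (\<Sum>k<n. lam / (\<xi> k * herglotz' (\<xi> k)) / (z - \<xi> k))"
    unfolding sum_distrib_left
  proof (intro sum.cong refl)
    fix k assume "k \<in> {..<n}"
    then have k: "k < n" by simp
    \<comment> \<open>The outer exponent times \<open>mass\<close> is \<open>lam\<close>, so each
      coefficient becomes \<open>- lam / (2 * kernel_mass)\<close>, which is the one in
      \<open>partial_fractions\<close>.\<close>
    have "?e * (2 * LK_alpha n \<zeta> (a / b) \<xi> k) = - (?e * of_real mass) / (2 * of_real (kernel_mass (\<xi> k)))"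
      unfolding LK_alpha_eq[OF k] by simp
    also have "\<dots> = lam / (\<xi> k * herglotz' (\<xi> k))"
      unfolding rotation_mass herglotz'_xi(1)[OF k] by simp
    finally have "?e * (2 * LK_alpha n \<zeta> (a / b) \<xi> k) = lam / (\<xi> k * herglotz' (\<xi> k))" .
    then show "?e * (2 * LK_alpha n \<zeta> (a / b) \<xi> k * (1 / (z - \<xi> k))) = lam / (\<xi> k * herglotz' (\<xi> k)) / (z - \<xi> k)"
      by (simp only: mult.assoc[symmetric] times_divide_eq_right mult_1_right)
  qed
  ultimately show ?thesis by (simp add: H_def[abs_def])
qed

sublocale sf: spiral_flow herglotz H b a
proof
  show "herglotz holomorphic_on ball 0 1"
    using herglotz_deriv ball_ne_zeta by (meson holomorphic_on_open open_ball)
  show "H holomorphic_on ball 0 1"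
    using H_deriv by (meson holomorphic_on_open open_ball)
  have "\<zeta> k \<noteq> 0" if "k < n" for k using zeta_circ[OF that] by auto
  then show "herglotz 0 = of_real b"
    unfolding herglotz_def b_def of_real_sum by (intro sum.cong) auto
  fix z :: complex assume z: "z \<in> ball 0 1"
  have "(norm z)\<^sup>2 < 1" using z by (simp add: abs_square_less_1)
  moreover have "kernel_mass z > 0" by (rule kernel_mass_pos) (rule ball_ne_zeta[OF z])
  ultimately show "0 < Re (herglotz z)"
    unfolding Re_herglotz by simp
  show "(1 + z * deriv H z) * (herglotz z - \<i> * of_real a) = of_real b - \<i> * of_real a"
    unfolding DERIV_imp_deriv[OF H_deriv[OF z]] lam_def[symmetric]
    using ball_ne_zeta[OF z] ball_ne_xi[OF z] by (rule partial_fractions)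
qed

lemma sf_lam: "sf.lam = lam"
  by (simp add: sf.lam_def lam_def)

lemma LK_phi_eq: "LK_phi n (LK_alpha n \<zeta> (a / b) \<xi>) (exp (\<i> * of_real (Arccot (a / b) - pi / 2))) L = sf.phi"
  by (rule ext) (simp add: LK_phi_def sf.phi_def H_def)

lemma herglotz_rotate:
  "herglotz (exp (- \<i> * of_real (a * t)) * z) =
    (\<Sum>k<n. of_real (bs k) * (exp (\<i> * of_real (a * t)) * \<zeta> k + z) /
       (exp (\<i> * of_real (a * t)) * \<zeta> k - z))"
  unfolding herglotz_def
proof (intro sum.cong refl)
  fix k
  define e where "e = exp (\<i> * of_real (a * t))"
  have e: "exp (- \<i> * of_real (a * t)) = 1 / e" "e \<noteq> 0"
    by (simp_all add: e_def exp_minus inverse_eq_divide)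
  have "(e * \<zeta> k + z) = e * (\<zeta> k + 1 / e * z)" "(e * \<zeta> k - z) = e * (\<zeta> k - 1 / e * z)"
    using e(2) by (simp_all add: algebra_simps)
  then show "of_real (bs k) * ((\<zeta> k + exp (- \<i> * of_real (a * t)) * z) / (\<zeta> k - exp (- \<i> * of_real (a * t)) * z)) =
     of_real (bs k) * (exp (\<i> * of_real (a * t)) * \<zeta> k + z) / (exp (\<i> * of_real (a * t)) * \<zeta> k - z)"
    unfolding e(1) e_def[symmetric] using e(2) by simp
qed

lemma solution: "LK_solution n \<zeta> bs a sf.flow"
  unfolding LK_solution_def herglotz_rotate[symmetric]
  by (intro conjI allI ballI impI sf.flow_continuous sf.flow_holo sf.flow_0 sf.flow_deriv_time)

lemma solution_unique:
  assumes "LK_solution n \<zeta> bs a g" "z \<in> ball 0 1" "t \<ge> 0"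
  shows "g z t = sf.flow z t"
  using assms(1) unfolding LK_solution_def herglotz_rotate[symmetric]
  by (intro sf.flow_unique assms(2,3)) blast+

lemma trace_exists:
  assumes "k < n"
  obtains \<gamma> C where
    "\<And>t. t \<ge> 0 \<Longrightarrow> ((\<lambda>z. sf.flow z t) \<longlongrightarrow> \<gamma> t) (at (exp (\<i> * of_real (a * t)) * \<zeta> k) within ball 0 1)"
    "\<gamma> 0 = \<zeta> k" "continuous_on {0..} \<gamma>"
    "((\<lambda>t. Arg (1 - cnj (\<zeta> k) * \<gamma> t)) \<longlongrightarrow> 0) (at_right 0)"
    "C \<noteq> 0"
    "\<And>t. t > 0 \<Longrightarrow> C * exp (- sf.lam * of_real t) \<in> sf.phi ` ball 0 1"
    "\<And>t. t > 0 \<Longrightarrow> \<gamma> t = sf.psi (C * exp (- sf.lam * of_real t))"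
proof -
  define P where "P z = (\<Prod>j\<in>{..<n} - {k}. \<zeta> j - z)" for z
  define X where "X z = (\<Prod>j<n. z - \<xi> j)" for z
  \<comment> \<open>This is \<open>phi' / phi\<close> with its zero at \<open>\<zeta> k\<close>
    divided out. Being rational it extends across the circle; \<open>V\<close> removes the zeros of
    its denominator.\<close>
  define M where "M z = lam * P z / (z * (K * X z))" for z
  define V where "V = - insert 0 (\<xi> ` {..<n})"
  have X_nz: "X z \<noteq> 0" if "z \<in> V" for z
    using that by (auto simp: X_def V_def)
  have \<zeta>_nz: "\<zeta> k \<noteq> 0" using zeta_circ[OF assms] by auto
  have "\<zeta> k \<noteq> \<xi> j" if "j < n" for j
    using xi_ne_zeta[OF that assms] by (rule not_sym)
  then have V_in: "\<zeta> k \<in> V" using \<zeta>_nz by (auto simp: V_def)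
  have V_open: "open V" unfolding V_def by (intro open_Compl finite_imp_closed) simp
  have V_0: "0 \<notin> V" by (simp add: V_def)
  have "P holomorphic_on V" "X holomorphic_on V"
    unfolding P_def[abs_def] X_def[abs_def] by (intro holomorphic_intros)+
  then have M_holo: "M holomorphic_on V"
    unfolding M_def[abs_def] using X_nz K_nz V_0
    by (intro holomorphic_on_divide holomorphic_on_mult holomorphic_on_const holomorphic_on_ident) auto
  have M_\<zeta>: "M (\<zeta> k) = sf.lam / (2 * of_real (bs k) * (\<zeta> k)\<^sup>2)"
  proof -
    have "K * X (\<zeta> k) = of_real (bs k) * (2 * \<zeta> k) * P (\<zeta> k)"
      unfolding X_def P_def by (rule factorization_zeta[OF assms])
    moreover have "P (\<zeta> k) \<noteq> 0" unfolding P_def by (rule zeta_prod_nz[OF assms])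
    ultimately show ?thesis by (simp add: M_def sf_lam power2_eq_square mult_ac)
  qed
  have phi_M: "deriv sf.phi z = (\<zeta> k - z) * M z * sf.phi z" if z: "z \<in> V \<inter> ball 0 1" for z
  proof -
    have KX: "K * X z = LK_R n \<zeta> z * (herglotz z - \<i> * of_real a)"
      unfolding X_def using ball_ne_zeta z by (intro factorization') auto
    have R: "LK_R n \<zeta> z = (\<zeta> k - z) * P z"
      unfolding LK_R_def P_def by (rule prod_lessThan_remove[OF assms])
    have nz: "z \<noteq> 0" "K * X z \<noteq> 0" using z X_nz[of z] K_nz by (auto simp: V_def)
    have "deriv sf.phi z * (z * (K * X z)) = LK_R n \<zeta> z * (z * deriv sf.phi z * (herglotz z - \<i> * of_real a))"
      unfolding KX by (simp only: mult_ac)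
    also have "\<dots> = (\<zeta> k - z) * (lam * P z) * sf.phi z"
      using sf.phi_field[of z] z unfolding R sf_lam by (simp only: Int_iff mult_ac)
    finally have "deriv sf.phi z = (\<zeta> k - z) * (lam * P z) * sf.phi z / (z * (K * X z))"
      using nz by (metis mult_eq_0_iff nonzero_eq_divide_eq)
    then show ?thesis by (simp add: M_def)
  qed
  obtain q r C where loc: "0 < r" "q holomorphic_on ball (\<zeta> k) r" "q (\<zeta> k) = 0"
    "deriv q (\<zeta> k) * \<zeta> k = - of_real (1 / (2 * sqrt (bs k)))" "C \<noteq> 0"
    "\<And>z. z \<in> ball 0 1 \<inter> ball (\<zeta> k) r \<Longrightarrow> sf.phi z = C * exp (- sf.lam * (q z)\<^sup>2)"
  proof (rule sf.local_square_root[OF zeta_circ[OF assms] V_in V_open V_0 bs_pos[OF assms] M_holo M_\<zeta> phi_M])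
    fix q r C
    assume "0 < r" "q holomorphic_on ball (\<zeta> k) r" "q (\<zeta> k) = 0"
      "deriv q (\<zeta> k) * \<zeta> k = - of_real (1 / (2 * sqrt (bs k)))" "C \<noteq> 0"
      "\<And>z. z \<in> ball 0 1 \<inter> ball (\<zeta> k) r \<Longrightarrow> sf.phi z = C * exp (- sf.lam * (q z)\<^sup>2)"
    then show thesis by (rule that)
  qed
  have \<kappa>: "0 < 1 / (2 * sqrt (bs k))" using bs_pos[OF assms] by simp
  show ?thesis
  proof (rule sf.boundary_trace[OF zeta_circ[OF assms] loc(1-3) \<kappa> loc(4-6)])
    fix \<gamma> :: "real \<Rightarrow> complex"
    assume g: "\<And>t. t \<ge> 0 \<Longrightarrow> ((\<lambda>z. sf.flow z t) \<longlongrightarrow> \<gamma> t) (at (exp (\<i> * of_real (a * t)) * \<zeta> k) within ball 0 1)"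
      "\<gamma> 0 = \<zeta> k" "continuous_on {0..} \<gamma>"
      and t: "\<And>t. t > 0 \<Longrightarrow> C * exp (- sf.lam * of_real t) \<in> sf.phi ` ball 0 1"
      "\<And>t. t > 0 \<Longrightarrow> \<gamma> t = sf.psi (C * exp (- sf.lam * of_real t))"
      and arg: "((\<lambda>t. Arg (1 - cnj (\<zeta> k) * \<gamma> t)) \<longlongrightarrow> 0) (at_right 0)"
    show thesis by (rule that[OF g arg loc(5) t])
  qed
qed

lemma trace:
  assumes "k < n"
  shows "\<exists>\<gamma> :: real \<Rightarrow> complex.
     (\<forall>t\<ge>0. ((\<lambda>z. sf.flow z t) \<longlongrightarrow> \<gamma> t)
                (at (exp (\<i> * of_real (a * t)) * \<zeta> k) within ball 0 1)) \<and>
     \<gamma> 0 = \<zeta> k \<and>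
     continuous_on {0..} \<gamma> \<and> smooth_curve_on {0<..} \<gamma> \<and>
     (\<forall>t>0. \<gamma> t \<in> ball 0 1) \<and>
     ((\<lambda>t. Arg (1 - cnj (\<zeta> k) * \<gamma> t)) \<longlongrightarrow> 0) (at_right 0) \<and>
     strict_antimono_on {0..} (\<lambda>t. norm (\<gamma> t)) \<and>
     ((\<lambda>t. norm (\<gamma> t)) \<longlongrightarrow> 0) at_top \<and>
     (\<exists>\<Theta>. continuous_on {0..} \<Theta> \<and>
         (\<forall>t\<ge>0. \<gamma> t = of_real (norm (\<gamma> t)) * exp (\<i> * of_real (\<Theta> t)))) \<and>
     (a \<noteq> 0 \<longrightarrow>
       (\<forall>\<Theta>. continuous_on {0..} \<Theta> \<and>
         (\<forall>t\<ge>0. \<gamma> t = of_real (norm (\<gamma> t)) * exp (\<i> * of_real (\<Theta> t))) \<longrightarrow>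
         (\<exists>T. strict_mono_on {T..} (\<lambda>t. sgn a * \<Theta> t)) \<and>
         filterlim (\<lambda>t. sgn a * \<Theta> t) at_top at_top))"
proof -
  obtain \<gamma> C where \<gamma>:
    "\<And>t. t \<ge> 0 \<Longrightarrow> ((\<lambda>z. sf.flow z t) \<longlongrightarrow> \<gamma> t) (at (exp (\<i> * of_real (a * t)) * \<zeta> k) within ball 0 1)"
    "\<gamma> 0 = \<zeta> k" "continuous_on {0..} \<gamma>"
    "((\<lambda>t. Arg (1 - cnj (\<zeta> k) * \<gamma> t)) \<longlongrightarrow> 0) (at_right 0)"
    and traj: "C \<noteq> 0"
    "\<And>t. t > 0 \<Longrightarrow> C * exp (- sf.lam * of_real t) \<in> sf.phi ` ball 0 1"
    "\<And>t. t > 0 \<Longrightarrow> \<gamma> t = sf.psi (C * exp (- sf.lam * of_real t))"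
  proof (rule trace_exists[OF assms])
    fix \<gamma> C
    assume "\<And>t. t \<ge> 0 \<Longrightarrow> ((\<lambda>z. sf.flow z t) \<longlongrightarrow> \<gamma> t) (at (exp (\<i> * of_real (a * t)) * \<zeta> k) within ball 0 1)"
      "\<gamma> 0 = \<zeta> k" "continuous_on {0..} \<gamma>"
      "((\<lambda>t. Arg (1 - cnj (\<zeta> k) * \<gamma> t)) \<longlongrightarrow> 0) (at_right 0)" "C \<noteq> 0"
      "\<And>t. t > 0 \<Longrightarrow> C * exp (- sf.lam * of_real t) \<in> sf.phi ` ball 0 1"
      "\<And>t. t > 0 \<Longrightarrow> \<gamma> t = sf.psi (C * exp (- sf.lam * of_real t))"
    then show thesis by (rule that)
  qed
  have in_ball: "\<gamma> t \<in> ball 0 1" if "t > 0" for t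
    using sf.traj_in[OF traj that] .
  have decr: "strict_antimono_on {0..} (\<lambda>t. norm (\<gamma> t))"
  proof (rule monotone_onI)
    fix s t :: real assume st: "s \<in> {0..}" "t \<in> {0..}" "s < t"
    show "norm (\<gamma> t) < norm (\<gamma> s)"
    \<comment> \<open>The trajectory facts cover positive times; at time 0 the modulus is 1, which
      exceeds every later one.\<close>
    proof (cases "s = 0")
      case True
      then show ?thesis using in_ball[of t] st \<gamma>(2) zeta_circ[OF assms] by simp
    next
      case False
      then show ?thesis using sf.traj_norm_less[OF traj, of s t] st by simp
    qed
  qed
  have nz: "\<gamma> t \<noteq> 0" if "t \<in> {0..}" for t
    using sf.traj_nz[OF traj, of t] that \<gamma>(2) zeta_circ[OF assms] by (cases "t = 0") auto
  \<comment> \<open>\<open>traj_log\<close> is controlled for positive times only, so a continuous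
    argument up to and including time 0 is taken from a logarithm of the nonvanishing curve on the
    whole half-line.\<close>
  obtain l where l: "continuous_on {0..} l" "\<And>t. t \<in> {0..} \<Longrightarrow> \<gamma> t = exp (l t)"
    using continuous_logarithm_on_contractible[OF \<gamma>(3) convex_imp_contractible nz] by auto
  have polar: "\<gamma> t = of_real (norm (\<gamma> t)) * exp (\<i> * of_real (Im (l t)))" if "t \<ge> 0" for t
  proof -
    have "norm (\<gamma> t) = exp (Re (l t))" using l(2)[of t] that by simp
    then show ?thesis using l(2)[of t] that exp_eq_polar[of "l t"] by (simp add: cis_conv_exp)
  qed
  have "continuous_on {0..} (\<lambda>t. Im (l t))" using l(1) by (intro continuous_intros)
  with polar have lift: "\<exists>\<Theta>. continuous_on {0..} \<Theta> \<and>
         (\<forall>t\<ge>0. \<gamma> t = of_real (norm (\<gamma> t)) * exp (\<i> * of_real (\<Theta> t)))"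
    by blast
  show ?thesis
  proof (intro exI[of _ \<gamma>] conjI)
    show "smooth_curve_on {0<..} \<gamma>" by (rule sf.traj_smooth[OF traj])
    show "((\<lambda>t. norm (\<gamma> t)) \<longlongrightarrow> 0) at_top"
      by (rule tendsto_norm_zero[OF sf.traj_tendsto_0[OF traj]])
    show "a \<noteq> 0 \<longrightarrow>
       (\<forall>\<Theta>. continuous_on {0..} \<Theta> \<and>
         (\<forall>t\<ge>0. \<gamma> t = of_real (norm (\<gamma> t)) * exp (\<i> * of_real (\<Theta> t))) \<longrightarrow>
         (\<exists>T. strict_mono_on {T..} (\<lambda>t. sgn a * \<Theta> t)) \<and>
         filterlim (\<lambda>t. sgn a * \<Theta> t) at_top at_top)"
    proof (intro impI allI)
      fix \<Theta> :: "real \<Rightarrow> real"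
      assume a: "a \<noteq> 0" and \<Theta>: "continuous_on {0..} \<Theta> \<and>
         (\<forall>t\<ge>0. \<gamma> t = of_real (norm (\<gamma> t)) * exp (\<i> * of_real (\<Theta> t)))"
      have pol: "\<gamma> t = of_real (norm (\<gamma> t)) * exp (\<i> * of_real (\<Theta> t))" if "t \<ge> 0" for t
        using \<Theta> that by blast
      show "(\<exists>T. strict_mono_on {T..} (\<lambda>t. sgn a * \<Theta> t)) \<and>
         filterlim (\<lambda>t. sgn a * \<Theta> t) at_top at_top"
        by (rule conjI; rule sf.traj_spirals[OF traj a conjunct1[OF \<Theta>] pol])
    qed
    show "\<forall>t\<ge>0. ((\<lambda>z. sf.flow z t) \<longlongrightarrow> \<gamma> t)
        (at (exp (\<i> * of_real (a * t)) * \<zeta> k) within ball 0 1)"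
      by (intro allI impI \<gamma>(1))
    show "\<forall>t>0. \<gamma> t \<in> ball 0 1" by (intro allI impI in_ball)
  qed (fact \<gamma> decr lift)+
qed

end

theorem theorem3p7:
  fixes n :: nat and \<zeta> :: "nat \<Rightarrow> complex" and bs :: "nat \<Rightarrow> real" and a :: real
    and \<xi> :: "nat \<Rightarrow> complex"
  assumes n_pos: "n \<ge> 1"
    and zeta_circ: "\<forall>k<n. norm (\<zeta> k) = 1"
    and zeta_inj: "inj_on \<zeta> {..<n}"
    and bs_pos: "\<forall>k<n. bs k > 0"
    and xi_def: "\<forall>z. LK_Q n \<zeta> bs z - \<i> * of_real a * LK_R n \<zeta> z =
        (-1) ^ (n - 1) * (of_real (\<Sum>k<n. bs k) + \<i> * of_real a) * (\<Prod>k<n. z - \<xi> k)"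
  shows
    "(\<forall>k<n. norm (\<xi> k) = 1) \<and> inj_on \<xi> {..<n} \<and>
     (\<forall>k<n. Im (LK_alpha n \<zeta> (a / (\<Sum>k<n. bs k)) \<xi> k) = 0 \<and>
            Re (LK_alpha n \<zeta> (a / (\<Sum>k<n. bs k)) \<xi> k) < 0) \<and>
     (\<forall>L :: nat \<Rightarrow> complex \<Rightarrow> complex.
        (\<forall>k<n. L k holomorphic_on ball 0 1 \<and> (\<forall>z\<in>ball 0 1. exp (L k z) = z - \<xi> k)) \<longrightarrow>
        (let b = (\<Sum>k<n. bs k);
             \<psi> = Arccot (a / b) - pi / 2;
             \<phi> = LK_phi n (LK_alpha n \<zeta> (a / b) \<xi>) (exp (\<i> * of_real \<psi>)) L;
             f = (\<lambda>z t. inv_into (ball 0 1) \<phi>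
                    (exp (- (of_real b - \<i> * of_real a) * of_real t) *
                     \<phi> (exp (- \<i> * of_real (a * t)) * z)))
         in spirallike \<psi> \<phi> \<and>
            LK_solution n \<zeta> bs a f \<and>
            (\<forall>g. LK_solution n \<zeta> bs a g \<longrightarrow>
                 (\<forall>z\<in>ball 0 1. \<forall>t\<ge>0. g z t = f z t)) \<and>
            (\<forall>k<n. \<exists>\<gamma> :: real \<Rightarrow> complex.
               (\<forall>t\<ge>0. ((\<lambda>z. f z t) \<longlongrightarrow> \<gamma> t)
                          (at (exp (\<i> * of_real (a * t)) * \<zeta> k) within ball 0 1)) \<and>
               \<gamma> 0 = \<zeta> k \<and>
               continuous_on {0..} \<gamma> \<and> smooth_curve_on {0<..} \<gamma> \<and>
               (\<forall>t>0. \<gamma> t \<in> ball 0 1) \<and>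
               ((\<lambda>t. Arg (1 - cnj (\<zeta> k) * \<gamma> t)) \<longlongrightarrow> 0) (at_right 0) \<and>
               strict_antimono_on {0..} (\<lambda>t. norm (\<gamma> t)) \<and>
               ((\<lambda>t. norm (\<gamma> t)) \<longlongrightarrow> 0) at_top \<and>
               (\<exists>\<Theta>. continuous_on {0..} \<Theta> \<and>
                   (\<forall>t\<ge>0. \<gamma> t = of_real (norm (\<gamma> t)) * exp (\<i> * of_real (\<Theta> t)))) \<and>
               (a \<noteq> 0 \<longrightarrow>
                 (\<forall>\<Theta>. continuous_on {0..} \<Theta> \<and>
                   (\<forall>t\<ge>0. \<gamma> t = of_real (norm (\<gamma> t)) * exp (\<i> * of_real (\<Theta> t))) \<longrightarrow>
                   (\<exists>T. strict_mono_on {T..} (\<lambda>t. sgn a * \<Theta> t)) \<and>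
                   filterlim (\<lambda>t. sgn a * \<Theta> t) at_top at_top)))))"
proof -
  interpret loewner_kufarev n \<zeta> bs a \<xi>
    using assms by unfold_locales auto
  have alpha: "Im (LK_alpha n \<zeta> (a / b) \<xi> k) = 0 \<and> Re (LK_alpha n \<zeta> (a / b) \<xi> k) < 0" if "k < n" for k
    using herglotz'_xi(2)[OF that] polar_arctan(4)[OF b_pos, of a, folded mass_def]
    unfolding LK_alpha_eq[OF that] by simp
  have main: "let b = b; \<psi> = Arccot (a / b) - pi / 2;
             \<phi> = LK_phi n (LK_alpha n \<zeta> (a / b) \<xi>) (exp (\<i> * of_real \<psi>)) L;
             f = (\<lambda>z t. inv_into (ball 0 1) \<phi>
                    (exp (- (of_real b - \<i> * of_real a) * of_real t) *
                     \<phi> (exp (- \<i> * of_real (a * t)) * z)))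
        in spirallike \<psi> \<phi> \<and> LK_solution n \<zeta> bs a f \<and>
            (\<forall>g. LK_solution n \<zeta> bs a g \<longrightarrow>
                 (\<forall>z\<in>ball 0 1. \<forall>t\<ge>0. g z t = f z t)) \<and>
            (\<forall>k<n. \<exists>\<gamma> :: real \<Rightarrow> complex.
               (\<forall>t\<ge>0. ((\<lambda>z. f z t) \<longlongrightarrow> \<gamma> t)
                          (at (exp (\<i> * of_real (a * t)) * \<zeta> k) within ball 0 1)) \<and>
               \<gamma> 0 = \<zeta> k \<and>
               continuous_on {0..} \<gamma> \<and> smooth_curve_on {0<..} \<gamma> \<and>
               (\<forall>t>0. \<gamma> t \<in> ball 0 1) \<and>
               ((\<lambda>t. Arg (1 - cnj (\<zeta> k) * \<gamma> t)) \<longlongrightarrow> 0) (at_right 0) \<and>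
               strict_antimono_on {0..} (\<lambda>t. norm (\<gamma> t)) \<and>
               ((\<lambda>t. norm (\<gamma> t)) \<longlongrightarrow> 0) at_top \<and>
               (\<exists>\<Theta>. continuous_on {0..} \<Theta> \<and>
                   (\<forall>t\<ge>0. \<gamma> t = of_real (norm (\<gamma> t)) * exp (\<i> * of_real (\<Theta> t)))) \<and>
               (a \<noteq> 0 \<longrightarrow>
                 (\<forall>\<Theta>. continuous_on {0..} \<Theta> \<and>
                   (\<forall>t\<ge>0. \<gamma> t = of_real (norm (\<gamma> t)) * exp (\<i> * of_real (\<Theta> t))) \<longrightarrow>
                   (\<exists>T. strict_mono_on {T..} (\<lambda>t. sgn a * \<Theta> t)) \<and>
                   filterlim (\<lambda>t. sgn a * \<Theta> t) at_top at_top)))"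
    if L: "\<forall>k<n. L k holomorphic_on ball 0 1 \<and> (\<forall>z\<in>ball 0 1. exp (L k z) = z - \<xi> k)" for L
  proof -
    interpret loewner_kufarev_branch n \<zeta> bs a \<xi> L
      using L by unfold_locales auto
    have flow: "inv_into (ball 0 1) sf.phi
                    (exp (- (of_real b - \<i> * of_real a) * of_real t) *
                     sf.phi (exp (- \<i> * of_real (a * t)) * z)) = sf.flow z t" for z t
      by (simp only: sf.flow_def sf.psi_def sf.lam_def)
    have "spirallike (Arccot (a / b) - pi / 2) sf.phi"
      using rotation_mass polar_arctan(4)[OF b_pos, of a, folded mass_def]
      by (intro sf.spirallike_phi[of _ mass]) (auto simp: sf_lam)
    note spiral = this
    show ?thesis
      unfolding Let_def LK_phi_eq flow
      by (intro conjI allI impI ballI spiral solution solution_unique trace)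
  qed
  show ?thesis
    unfolding b_def[symmetric]
    by (intro conjI allI impI norm_xi xi_inj alpha[THEN conjunct1] alpha[THEN conjunct2])
       (assumption | rule main)+
qed

end
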